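(* Let $\{A_\alpha\}_{\alpha\in\Omega},\{\Psi_\alpha\}_{\alpha\in\Omega}$ be in $\mathcal{B}(\mathcal{H},\mathcal{H}_0)$. Suppose $\{e_{\alpha,\beta}\}_{\beta\in\Omega_\alpha}$ is an orthonormal basis for $\mathcal{H}_0$, for each $\alpha\in\Omega$. Let $u_{\alpha,\beta}=A_\alpha^*e_{\alpha,\beta}$ and $v_{\alpha,\beta}=\Psi_\alpha^*e_{\alpha,\beta}$ for all $\beta\in\Omega_\alpha$, $\alpha\in\Omega$. Let (M) be the condition: for each $h\in\mathcal{H}$, both maps $\Omega\ni\alpha\mapsto\sum_{\beta\in\Omega_\alpha}\langle h,u_{\alpha,\beta}\rangle e_{\alpha,\beta}\in\mathcal{H}_0$ and $\Omega\ni\alpha\mapsto\sum_{\beta\in\Omega_\alpha}\langle h,v_{\alpha,\beta}\rangle e_{\alpha,\beta}\in\mathcal{H}_0$ are measurable. For $c,d>0$ let (B$_{c,d}$) be the condition $$\int_\Omega\sum_{\beta\in\Omega_\alpha}|\langle h,u_{\alpha,\beta}\rangle|^2\,d\mu(\alpha)\le c\|h\|^2,\quad\int_\Omega\sum_{\beta\in\Omega_\alpha}|\langle h,v_{\alpha,\beta}\rangle|^2\,d\mu(\alpha)\le d\|h\|^2,\qquad\forall h\in\mathcal{H}.$$ Then: (i) $(\{A_\alpha\}_{\alpha\in\Omega},\{\Psi_\alpha\}_{\alpha\in\Omega})$ is a continuous operator-valued frame in $\mathcal{B}(\mathcal{H},\mathcal{H}_0)$ with bounds $a$ and $b$ if and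 only if (M) holds and there exist $c,d>0$ such that the map $T:\mathcal{H}\ni h\mapsto\int_\Omega\sum_{\beta\in\Omega_\alpha}\langle h,u_{\alpha,\beta}\rangle v_{\alpha,\beta}\,d\mu(\alpha)\in\mathcal{H}$ is a well-defined bounded positive invertible operator with $a\|h\|^2\le\langle Th,h\rangle\le b\|h\|^2$ for all $h\in\mathcal{H}$, and (B$_{c,d}$) holds. (ii) $(\{A_\alpha\}_{\alpha\in\Omega},\{\Psi_\alpha\}_{\alpha\in\Omega})$ is continuous Bessel in $\mathcal{B}(\mathcal{H},\mathcal{H}_0)$ with bound $b$ if and only if (M) holds and there exist $c,d>0$ such that the map $T$ of (i) is a well-defined bounded positive operator with $0\le\langle Th,h\rangle\le b\|h\|^2$ for all $h\in\mathcal{H}$, and (B$_{c,d}$) holds. (iii) $(\{A_\alpha\}_{\alpha\in\Omega},\{\Psi_\alpha\}_{\alpha\in\Omega})$ is a continuous operator-valued frame in $\mathcal{B}(\mathcal{H},\mathcal{H}_0)$ with bounds $a$ and $b$ if and only if (M) holds and there exist $c,d,r>0$ such that for all $h\in\mathcal{H}$ $$\left\|\int_\Omega\sum_{\beta\in\Omega_\alpha}\langle h,u_{\alpha,\beta}\rangle v_{\alpha,\beta}\,d\mu(\alpha)\right\|\le r\|h\|,$$ $$\int_\Omega\sum_{\beta\in\Omega_\alpha}\langle h,u_{\alpha,\beta}\rangle v_{\alpha,\beta}\,d\mu(\alpha)=\int_\Omega\sum_{\beta\in\Omega_\alpha}\langle h,v_{\alpha,\beta}\rangle u_{\alpha,\beta}\,d\mu(\alpha),$$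 $$a\|h\|^2\le\int_\Omega\sum_{\beta\in\Omega_\alpha}\langle h,u_{\alpha,\beta}\rangle\langle v_{\alpha,\beta},h\rangle\,d\mu(\alpha)\le b\|h\|^2,$$ and (B$_{c,d}$) holds. (iv) $(\{A_\alpha\}_{\alpha\in\Omega},\{\Psi_\alpha\}_{\alpha\in\Omega})$ is continuous Bessel in $\mathcal{B}(\mathcal{H},\mathcal{H}_0)$ with bound $b$ if and only if (M) holds and there exist $c,d,r>0$ such that the conditions listed in (iii) hold with the third one replaced by $0\le\int_\Omega\sum_{\beta\in\Omega_\alpha}\langle h,u_{\alpha,\beta}\rangle\langle v_{\alpha,\beta},h\rangle\,d\mu(\alpha)\le b\|h\|^2$ for all $h\in\mathcal{H}$.
   Context: $\mathcal{H},\mathcal{H}_0$ are Hilbert spaces over $\mathbb{K}\in\{\mathbb{R},\mathbb{C}\}$; $\mathcal{B}(\mathcal{H},\mathcal{H}_0)$ denotes bounded linear operators; $(\Omega,\mu)$ is a measure space with positive measure; each $\Omega_\alpha$ is an index set. All vector-valued integrals are weak: $\int_\Omega F\,d\mu$ is the element of $\mathcal{H}$ with $\langle\int_\Omega F\,d\mu,g\rangle=\int_\Omega\langle F(\alpha),g\rangle\,d\mu(\alpha)$ for all $g\in\mathcal{H}$. A collection $\{A_\alpha\}_{\alpha\in\Omega}$ in $\mathcal{B}(\mathcal{H},\mathcal{H}_0)$ is a continuous operator-valued frame with respect to $\{\Psi_\alpha\}_{\alpha\in\Omega}$ in $\mathcal{B}(\mathcal{H},\mathcal{H}_0)$ (one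 says $(\{A_\alpha\}_{\alpha\in\Omega},\{\Psi_\alpha\}_{\alpha\in\Omega})$ is a continuous operator-valued frame) if: (1) for each $h\in\mathcal{H}$ the maps $\alpha\mapsto A_\alpha h$ and $\alpha\mapsto\Psi_\alpha h$ are measurable; (2) the frame operator $S_{A,\Psi}:\mathcal{H}\ni h\mapsto\int_\Omega\Psi_\alpha^*A_\alpha h\,d\mu(\alpha)\in\mathcal{H}$ is a well-defined bounded positive invertible operator; (3) the analysis operators $\theta_A,\theta_\Psi:\mathcal{H}\to\mathcal{L}^2(\Omega,\mathcal{H}_0)$, $(\theta_Ah)(\alpha)=A_\alpha h$, $(\theta_\Psi h)(\alpha)=\Psi_\alpha h$, are well-defined bounded linear operators. If in (2) invertibility is dropped (only bounded and positive), the pair is called continuous Bessel. Bounds $a,b>0$ of a frame mean $a\|h\|^2\le\langle S_{A,\Psi}h,h\rangle\le b\|h\|^2$ for all $h$; bound $b$ of a Bessel pair means $0\le\langle S_{A,\Psi}h,h\rangle\le b\|h\|^2$ for all $h$. *)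

theory Defs
  imports "HOL-Analysis.Analysis" "HOL-Library.Complex_Order"
begin

text \<open>
  The scalar field, treated uniformly for the reals and the complex numbers. Axiom \<open>rc_deg\<close> says
  that the degree over the reals is at most two, so up to isomorphism these two are the only
  instances; the conjugation and the order are then determined by the last two axioms.
  On the complex numbers the order is the one of \<^theory>\<open>HOL-Library.Complex_Order\<close>, i.e. an
  inequality between scalars entails that their difference is real.
\<close>

class rc_scalar = real_normed_field + banach + second_countable_topology + order +
  fixes kcnj :: "'a \<Rightarrow> 'a"
  assumes rc_deg: "\<exists>i. \<forall>z. \<exists>x y. z = x *\<^sub>R 1 + y *\<^sub>R i"
    and kcnj_add: "kcnj (x + y) = kcnj x + kcnj y"
    and kcnj_mult: "kcnj (x * y) = kcnj x * kcnj y"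
    and mult_kcnj: "x * kcnj x = ((norm x)\<^sup>2) *\<^sub>R 1"
    and le_iff_diff_real: "x \<le> y \<longleftrightarrow> (\<exists>r\<ge>0. y - x = r *\<^sub>R 1)"

instantiation real :: rc_scalar
begin
definition kcnj_real :: "real \<Rightarrow> real" where "kcnj_real x = x"
instance
proof
  show "\<exists>i::real. \<forall>z. \<exists>x y. z = x *\<^sub>R 1 + y *\<^sub>R i"
    by (rule exI[of _ 0]) simp
  fix x y :: real
  show "x \<le> y \<longleftrightarrow> (\<exists>r\<ge>0. y - x = r *\<^sub>R 1)"
    by (auto intro!: exI[of _ "y - x"])
qed (simp_all add: kcnj_real_def power2_eq_square)
end

instantiation complex :: rc_scalar
begin
definition kcnj_complex :: "complex \<Rightarrow> complex" where "kcnj_complex z = cnj z"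
instance
proof
  show "\<exists>i::complex. \<forall>z. \<exists>x y. z = x *\<^sub>R 1 + y *\<^sub>R i"
    by (rule exI[of _ \<i>]) (auto simp: complex_eq_iff)
  fix x y :: complex
  show "x * kcnj x = ((norm x)\<^sup>2) *\<^sub>R 1"
    by (simp add: kcnj_complex_def complex_norm_square[symmetric] scaleR_conv_of_real del: of_real_power)
  show "x \<le> y \<longleftrightarrow> (\<exists>r\<ge>0. y - x = r *\<^sub>R 1)"
  proof
    assume "x \<le> y"
    then show "\<exists>r\<ge>0. y - x = r *\<^sub>R 1"
      by (intro exI[of _ "Re y - Re x"]) (auto simp: less_eq_complex_def complex_eq_iff)
  next
    assume "\<exists>r\<ge>0. y - x = r *\<^sub>R 1"
    then show "x \<le> y"
      by (auto simp: less_eq_complex_def complex_eq_iff)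
  qed
qed (simp_all add: kcnj_complex_def)
end

text \<open>
  A Hilbert space over the scalars \<open>'k\<close>: a complete normed space whose norm comes from
  an inner product that is linear in its first argument.
\<close>

locale hilbert_space = vector_space scl
  for scl :: "'k::rc_scalar \<Rightarrow> 'h::banach \<Rightarrow> 'h" +
  fixes ip :: "'h \<Rightarrow> 'h \<Rightarrow> 'k"
  assumes scl_of_real: "scl (of_real r) x = r *\<^sub>R x"
    and ip_add_left: "ip (x + y) z = ip x z + ip y z"
    and ip_scl_left: "ip (scl c x) z = c * ip x z"
    and ip_commute: "ip y x = kcnj (ip x y)"
    and ip_self: "ip x x = of_real ((norm x)\<^sup>2)"

lemma hilbert_space_real_inner:
  "hilbert_space scaleR (inner :: 'h::{real_inner, banach} \<Rightarrow> 'h \<Rightarrow> real)"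
  by unfold_locales
    (auto simp: algebra_simps inner_commute kcnj_real_def power2_norm_eq_inner)

lemma hilbert_space_complex: "hilbert_space (*) (\<lambda>z w :: complex. z * cnj w)"
  by unfold_locales
    (auto simp: algebra_simps kcnj_complex_def scaleR_conv_of_real complex_norm_square
      simp del: of_real_power)

definition bounded_op ::
  "('k::rc_scalar \<Rightarrow> 'h::banach \<Rightarrow> 'h) \<Rightarrow> ('k \<Rightarrow> 'g::banach \<Rightarrow> 'g) \<Rightarrow> ('h \<Rightarrow> 'g) \<Rightarrow> bool" where
  "bounded_op scl scl' A \<longleftrightarrow> bounded_linear A \<and> (\<forall>c x. A (scl c x) = scl' c (A x))"

definition adj ::
  "('h \<Rightarrow> 'h \<Rightarrow> 'k) \<Rightarrow> ('g \<Rightarrow> 'g \<Rightarrow> 'k) \<Rightarrow> ('h \<Rightarrow> 'g) \<Rightarrow> 'g \<Rightarrow> 'h" where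
  "adj ip ip' A = (THE B. \<forall>x y. ip' (A x) y = ip x (B y))"

text \<open>Over the reals, self-adjointness does not follow from the second conjunct.\<close>

definition positive_op :: "('h \<Rightarrow> 'h \<Rightarrow> 'k::rc_scalar) \<Rightarrow> ('h \<Rightarrow> 'h) \<Rightarrow> bool" where
  "positive_op ip S \<longleftrightarrow> (\<forall>x y. ip (S x) y = ip x (S y)) \<and> (\<forall>x. 0 \<le> ip (S x) x)"

definition invertible_op ::
  "('k::rc_scalar \<Rightarrow> 'h::banach \<Rightarrow> 'h) \<Rightarrow> ('h \<Rightarrow> 'h) \<Rightarrow> bool" where
  "invertible_op scl S \<longleftrightarrow> (\<exists>R. bounded_op scl scl R \<and> S \<circ> R = id \<and> R \<circ> S = id)"

definition orthonormal_basis ::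
  "('k::rc_scalar \<Rightarrow> 'h::banach \<Rightarrow> 'h) \<Rightarrow> ('h \<Rightarrow> 'h \<Rightarrow> 'k) \<Rightarrow> 'b set \<Rightarrow> ('b \<Rightarrow> 'h) \<Rightarrow> bool" where
  "orthonormal_basis scl ip I e \<longleftrightarrow>
     (\<forall>i\<in>I. \<forall>j\<in>I. ip (e i) (e j) = (if i = j then 1 else 0)) \<and>
     closure (module.span scl (e ` I)) = UNIV"

definition has_weak_integral ::
  "('h \<Rightarrow> 'h \<Rightarrow> 'k::rc_scalar) \<Rightarrow> 'a measure \<Rightarrow> ('a \<Rightarrow> 'h) \<Rightarrow> 'h \<Rightarrow> bool" where
  "has_weak_integral ip M F J \<longleftrightarrow>
     (\<forall>g. integrable M (\<lambda>\<alpha>. ip (F \<alpha>) g) \<and> ip J g = (\<integral>\<alpha>. ip (F \<alpha>) g \<partial>M))"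

definition weak_integrable ::
  "('h \<Rightarrow> 'h \<Rightarrow> 'k::rc_scalar) \<Rightarrow> 'a measure \<Rightarrow> ('a \<Rightarrow> 'h) \<Rightarrow> bool" where
  "weak_integrable ip M F \<longleftrightarrow> (\<exists>J. has_weak_integral ip M F J)"

definition weak_integral ::
  "('h \<Rightarrow> 'h \<Rightarrow> 'k::rc_scalar) \<Rightarrow> 'a measure \<Rightarrow> ('a \<Rightarrow> 'h) \<Rightarrow> 'h" where
  "weak_integral ip M F = (THE J. has_weak_integral ip M F J)"

definition sq_integrable :: "'a measure \<Rightarrow> ('a \<Rightarrow> 'g::banach) \<Rightarrow> bool" where
  "sq_integrable M f \<longleftrightarrow> f \<in> borel_measurable M \<and> integrable M (\<lambda>\<alpha>. (norm (f \<alpha>))\<^sup>2)"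

definition norm_L2 :: "'a measure \<Rightarrow> ('a \<Rightarrow> 'g::banach) \<Rightarrow> real" where
  "norm_L2 M f = sqrt (\<integral>\<alpha>. (norm (f \<alpha>))\<^sup>2 \<partial>M)"

text \<open>
  \<open>\<theta>\<close> is a well-defined bounded linear operator into the space \<open>L\<^sup>2\<close> of vector-valued functions;
  elements of \<open>L\<^sup>2\<close> are represented by functions and their equality is equality almost everywhere.
\<close>

definition bounded_op_L2 ::
  "('k::rc_scalar \<Rightarrow> 'h::banach \<Rightarrow> 'h) \<Rightarrow> ('k \<Rightarrow> 'g::banach \<Rightarrow> 'g) \<Rightarrow> 'a measure \<Rightarrow>
    ('h \<Rightarrow> 'a \<Rightarrow> 'g) \<Rightarrow> bool" where
  "bounded_op_L2 scl scl' M \<theta> \<longleftrightarrow>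
     (\<forall>h. sq_integrable M (\<theta> h)) \<and>
     (\<forall>x y. AE \<alpha> in M. \<theta> (x + y) \<alpha> = \<theta> x \<alpha> + \<theta> y \<alpha>) \<and>
     (\<forall>c x. AE \<alpha> in M. \<theta> (scl c x) \<alpha> = scl' c (\<theta> x \<alpha>)) \<and>
     (\<exists>C. \<forall>h. norm_L2 M (\<theta> h) \<le> C * norm h)"

definition analysis_op :: "('a \<Rightarrow> 'h \<Rightarrow> 'g) \<Rightarrow> 'h \<Rightarrow> 'a \<Rightarrow> 'g" where
  "analysis_op A h = (\<lambda>\<alpha>. A \<alpha> h)"

definition frame_op ::
  "('h \<Rightarrow> 'h \<Rightarrow> 'k::rc_scalar) \<Rightarrow> ('g \<Rightarrow> 'g \<Rightarrow> 'k) \<Rightarrow> 'a measure \<Rightarrow>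
    ('a \<Rightarrow> 'h \<Rightarrow> 'g) \<Rightarrow> ('a \<Rightarrow> 'h \<Rightarrow> 'g) \<Rightarrow> 'h \<Rightarrow> 'h" where
  "frame_op ip ip' M A \<Psi> h = weak_integral ip M (\<lambda>\<alpha>. adj ip ip' (\<Psi> \<alpha>) (A \<alpha> h))"

definition continuous_bessel ::
  "('k::rc_scalar \<Rightarrow> 'h::banach \<Rightarrow> 'h) \<Rightarrow> ('h \<Rightarrow> 'h \<Rightarrow> 'k) \<Rightarrow>
    ('k \<Rightarrow> 'g::banach \<Rightarrow> 'g) \<Rightarrow> ('g \<Rightarrow> 'g \<Rightarrow> 'k) \<Rightarrow> 'a measure \<Rightarrow>
    ('a \<Rightarrow> 'h \<Rightarrow> 'g) \<Rightarrow> ('a \<Rightarrow> 'h \<Rightarrow> 'g) \<Rightarrow> bool" where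
  "continuous_bessel scl ip scl' ip' M A \<Psi> \<longleftrightarrow>
     (\<forall>\<alpha>\<in>space M. bounded_op scl scl' (A \<alpha>) \<and> bounded_op scl scl' (\<Psi> \<alpha>)) \<and>
     (\<forall>h. (\<lambda>\<alpha>. A \<alpha> h) \<in> borel_measurable M \<and> (\<lambda>\<alpha>. \<Psi> \<alpha> h) \<in> borel_measurable M) \<and>
     (\<forall>h. weak_integrable ip M (\<lambda>\<alpha>. adj ip ip' (\<Psi> \<alpha>) (A \<alpha> h))) \<and>
     bounded_op scl scl (frame_op ip ip' M A \<Psi>) \<and>
     positive_op ip (frame_op ip ip' M A \<Psi>) \<and>
     bounded_op_L2 scl scl' M (analysis_op A) \<and> bounded_op_L2 scl scl' M (analysis_op \<Psi>)"

definition continuous_ov_frame ::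
  "('k::rc_scalar \<Rightarrow> 'h::banach \<Rightarrow> 'h) \<Rightarrow> ('h \<Rightarrow> 'h \<Rightarrow> 'k) \<Rightarrow>
    ('k \<Rightarrow> 'g::banach \<Rightarrow> 'g) \<Rightarrow> ('g \<Rightarrow> 'g \<Rightarrow> 'k) \<Rightarrow> 'a measure \<Rightarrow>
    ('a \<Rightarrow> 'h \<Rightarrow> 'g) \<Rightarrow> ('a \<Rightarrow> 'h \<Rightarrow> 'g) \<Rightarrow> bool" where
  "continuous_ov_frame scl ip scl' ip' M A \<Psi> \<longleftrightarrow>
     continuous_bessel scl ip scl' ip' M A \<Psi> \<and> invertible_op scl (frame_op ip ip' M A \<Psi>)"

definition op_bounds ::
  "('h::real_normed_vector \<Rightarrow> 'h \<Rightarrow> 'k::rc_scalar) \<Rightarrow> ('h \<Rightarrow> 'h) \<Rightarrow> real \<Rightarrow> real \<Rightarrow> bool" where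
  "op_bounds ip S a b \<longleftrightarrow>
     (\<forall>h. of_real (a * (norm h)\<^sup>2) \<le> ip (S h) h \<and> ip (S h) h \<le> of_real (b * (norm h)\<^sup>2))"

definition continuous_ov_frame_bounds ::
  "('k::rc_scalar \<Rightarrow> 'h::banach \<Rightarrow> 'h) \<Rightarrow> ('h \<Rightarrow> 'h \<Rightarrow> 'k) \<Rightarrow>
    ('k \<Rightarrow> 'g::banach \<Rightarrow> 'g) \<Rightarrow> ('g \<Rightarrow> 'g \<Rightarrow> 'k) \<Rightarrow> 'a measure \<Rightarrow>
    ('a \<Rightarrow> 'h \<Rightarrow> 'g) \<Rightarrow> ('a \<Rightarrow> 'h \<Rightarrow> 'g) \<Rightarrow> real \<Rightarrow> real \<Rightarrow> bool" where
  "continuous_ov_frame_bounds scl ip scl' ip' M A \<Psi> a b \<longleftrightarrow>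
     continuous_ov_frame scl ip scl' ip' M A \<Psi> \<and> op_bounds ip (frame_op ip ip' M A \<Psi>) a b"

definition continuous_bessel_bound ::
  "('k::rc_scalar \<Rightarrow> 'h::banach \<Rightarrow> 'h) \<Rightarrow> ('h \<Rightarrow> 'h \<Rightarrow> 'k) \<Rightarrow>
    ('k \<Rightarrow> 'g::banach \<Rightarrow> 'g) \<Rightarrow> ('g \<Rightarrow> 'g \<Rightarrow> 'k) \<Rightarrow> 'a measure \<Rightarrow>
    ('a \<Rightarrow> 'h \<Rightarrow> 'g) \<Rightarrow> ('a \<Rightarrow> 'h \<Rightarrow> 'g) \<Rightarrow> real \<Rightarrow> bool" where
  "continuous_bessel_bound scl ip scl' ip' M A \<Psi> b \<longleftrightarrow>
     continuous_bessel scl ip scl' ip' M A \<Psi> \<and> op_bounds ip (frame_op ip ip' M A \<Psi>) 0 b"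

end

theory Submission imports Defs begin

text \<open>
  Since \<open>\<langle>h, u\<^bsub>\<alpha>,\<beta>\<^esub>\<rangle> = \<langle>A\<^sub>\<alpha> h, e\<^bsub>\<alpha>,\<beta>\<^esub>\<rangle>\<close>, expanding \<open>A\<^sub>\<alpha> h\<close> and \<open>\<Psi>\<^sub>\<alpha> h\<close> in the orthonormal
  basis identifies each series in the conditions pointwise in \<open>\<alpha>\<close>: the sums in (M) are \<open>A\<^sub>\<alpha> h\<close> and
  \<open>\<Psi>\<^sub>\<alpha> h\<close>, those in (B) are \<open>\<parallel>A\<^sub>\<alpha> h\<parallel>\<^sup>2\<close> and \<open>\<parallel>\<Psi>\<^sub>\<alpha> h\<parallel>\<^sup>2\<close>, and \<open>T\<close> is the frame operator. So (B) is
  boundedness of the analysis operators. For (iii) and (iv), equality of the two weak integrals is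
  self-adjointness of \<open>T\<close>, and a positive lower bound makes \<open>x \<mapsto> x + t (y - T x)\<close> a contraction for
  small \<open>t > 0\<close>, so that invertibility is automatic.
\<close>


section \<open>Conjugation and order on the scalars\<close>

lemma kcnj_0 [simp]: "kcnj (0::'k::rc_scalar) = 0"
  using kcnj_add[of 0 "0::'k"] by simp

lemma norm_kcnj [simp]: "norm (kcnj x) = norm (x::'k::rc_scalar)"
proof (cases "x = 0")
  case False
  have "norm x * norm (kcnj x) = norm x * norm x"
    using arg_cong[OF mult_kcnj[of x], of norm] by (simp add: norm_mult power2_eq_square)
  then show ?thesis using False by simp
qed simp

lemma kcnj_of_real [simp]: "kcnj (of_real r) = (of_real r :: 'k::rc_scalar)"
proof (cases "r = 0")
  case False
  have "of_real r * kcnj (of_real r) = (of_real r * of_real r :: 'k)"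
    using mult_kcnj[of "of_real r :: 'k"]
    by (simp add: scaleR_conv_of_real power2_eq_square flip: of_real_mult)
  then show ?thesis using False by simp
qed simp

text \<open>Since \<open>kcnj\<close> preserves the norm, \<open>mult_kcnj\<close> gives the same
  product for \<open>x\<close> and for \<open>kcnj x\<close>; cancelling the common factor
  \<open>kcnj x\<close> leaves the claim.\<close>

lemma kcnj_kcnj [simp]: "kcnj (kcnj x) = (x::'k::rc_scalar)"
proof (cases "x = 0")
  case False
  have "kcnj x \<noteq> 0" using False norm_kcnj[of x] by (metis norm_eq_zero)
  moreover have "kcnj x * kcnj (kcnj x) = kcnj x * x"
    using mult_kcnj[of x] mult_kcnj[of "kcnj x"] by (simp add: mult.commute)
  ultimately show ?thesis by simp
qed simp

lemma kcnj_eq_0_iff [simp]: "kcnj x = 0 \<longleftrightarrow> x = (0::'k::rc_scalar)"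
  by (metis norm_kcnj norm_eq_zero)

text \<open>Lets conjugation pass under Bochner integrals. Linearity is over the reals, as
  conjugation is not linear over the complex numbers.\<close>

lemma bounded_linear_kcnj: "bounded_linear (kcnj :: 'k::rc_scalar \<Rightarrow> 'k)"
  by (rule bounded_linear_intro[of _ 1]) (simp_all add: kcnj_add scaleR_conv_of_real kcnj_mult)

text \<open>
  As \<open>real\<close> is itself an instance, a general use of \<open>le_iff_diff_real\<close> rewrites its own side condition
  \<open>r \<ge> 0\<close> forever; it has to be instantiated.
\<close>

lemma of_real_le_rc_iff [simp]: "(of_real r :: 'k::rc_scalar) \<le> of_real s \<longleftrightarrow> r \<le> s"
proof -
  have "(of_real s - of_real r :: 'k) = t *\<^sub>R 1 \<longleftrightarrow> s - r = t" for t
    by (simp only: of_real_def[symmetric, where 'a='k] of_real_diff[symmetric] of_real_eq_iff)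
  then show ?thesis by (auto simp: le_iff_diff_real[of "of_real r :: 'k"])
qed

text \<open>The order compares only scalars whose difference is real, so a scalar above a real
  number is itself real. This extracts a real number from an inequality in
  \<open>'k\<close>.\<close>

lemma of_real_le_rcE:
  assumes "of_real r \<le> (z::'k::rc_scalar)"
  obtains s where "r \<le> s" "z = of_real s"
proof -
  obtain t where "t \<ge> 0" "z - of_real r = t *\<^sub>R 1"
    using assms by (auto simp: le_iff_diff_real[of _ z])
  then show ?thesis by (intro that[of "r + t"]) (simp_all add: of_real_def algebra_simps)
qed

section \<open>Elementary geometry of the inner product\<close>

context hilbert_space
begin

lemma ip_zero_left [simp]: "ip 0 z = 0"
  using ip_add_left[of 0 0 z] by simp

lemma ip_diff_left: "ip (x - y) z = ip x z - ip y z"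
  using ip_add_left[of "x - y" y z] by simp

lemma ip_add_right: "ip x (y + z) = ip x y + ip x z"
  by (metis ip_commute ip_add_left kcnj_add)

lemma ip_zero_right [simp]: "ip x 0 = 0"
  using ip_add_right[of x 0 0] by simp

lemma ip_diff_right: "ip x (y - z) = ip x y - ip x z"
  using ip_add_right[of x "y - z" z] by simp

lemma ip_scl_right: "ip x (scl c y) = kcnj c * ip x y"
  by (metis ip_commute ip_scl_left kcnj_mult)

lemma ip_scaleR_left: "ip (r *\<^sub>R x) y = of_real r * ip x y"
  by (metis scl_of_real ip_scl_left)

lemma ip_sum_left: "ip (\<Sum>i\<in>F. f i) y = (\<Sum>i\<in>F. ip (f i) y)"
  by (induction F rule: infinite_finite_induct) (simp_all add: ip_add_left)

text \<open>Pythagoras for the projection of \<open>x\<close> onto the line through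
  \<open>y\<close>. Nonnegativity of the left side gives Cauchy-Schwarz; minimality of
  \<open>norm x\<close> gives orthogonality.\<close>

lemma norm_diff_proj:
  assumes "y \<noteq> 0"
  shows "(norm (x - scl (ip x y / of_real ((norm y)\<^sup>2)) y))\<^sup>2 = (norm x)\<^sup>2 - (norm (ip x y))\<^sup>2 / (norm y)\<^sup>2"
proof -
  let ?n = "of_real ((norm y)\<^sup>2) :: 'k" and ?c = "ip x y / of_real ((norm y)\<^sup>2)"
  have n: "?n \<noteq> 0" using assms by simp
  \<comment> \<open>As \<open>?n\<close> is real, conjugating \<open>?c * ?n = ip x y\<close> yields
    \<open>kcnj ?c * ?n = ip y x\<close>, so the fourth term of the expansion below cancels the
    second.\<close>
  have "kcnj ?c * ?n = kcnj (?c * ?n)" by (simp only: kcnj_mult kcnj_of_real)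
  then have c: "kcnj ?c * ?n = ip y x" using n by (simp add: ip_commute[of x y])
  have "(of_real ((norm (x - scl ?c y))\<^sup>2) :: 'k) =
      ip x x - ?c * ip y x - kcnj ?c * ip x y + ?c * (kcnj ?c * ?n)"
    by (simp add: ip_self[symmetric] ip_diff_left ip_diff_right ip_scl_left ip_scl_right algebra_simps
        del: of_real_power)
  also have "\<dots> = ip x x - kcnj ?c * ip x y" using c by simp
  also have "kcnj ?c * ip x y = kcnj ?c * ?n * ip x y / ?n" using n by simp
  also have "\<dots> = ip x y * kcnj (ip x y) / ?n" using c by (simp add: ip_commute[of x y] mult.commute)
  also have "ip x x - \<dots> = of_real ((norm x)\<^sup>2 - (norm (ip x y))\<^sup>2 / (norm y)\<^sup>2)"
    by (simp add: mult_kcnj scaleR_conv_of_real ip_self)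
  finally show ?thesis by (simp only: of_real_eq_iff)
qed

lemma Cauchy_Schwarz: "norm (ip x y) \<le> norm x * norm y"
proof (cases "y = 0")
  case False
  have "(norm (ip x y))\<^sup>2 / (norm y)\<^sup>2 \<le> (norm x)\<^sup>2"
    using norm_diff_proj[OF False, of x] by (smt (verit) zero_le_power2)
  then have "(norm (ip x y))\<^sup>2 \<le> (norm x * norm y)\<^sup>2"
    using False by (simp add: divide_le_eq power_mult_distrib)
  then show ?thesis by (rule power2_le_imp_le) simp
qed simp

lemma bounded_linear_ip_left: "bounded_linear (\<lambda>x. ip x y)"
  by (rule bounded_linear_intro[of _ "norm y"])
    (simp_all add: ip_add_left ip_scaleR_left scaleR_conv_of_real Cauchy_Schwarz)

text \<open>Used to show that a norm-minimizing sequence in a hyperplane is Cauchy.\<close>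

lemma parallelogram: "(norm (x - y :: 'h))\<^sup>2 + (norm (x + y))\<^sup>2 = 2 * (norm x)\<^sup>2 + 2 * (norm y)\<^sup>2"
proof -
  have "ip (x - y) (x - y) + ip (x + y) (x + y) = 2 * ip x x + 2 * ip y y"
    by (simp add: ip_add_left ip_add_right ip_diff_left ip_diff_right)
  then have "(of_real ((norm (x - y))\<^sup>2 + (norm (x + y))\<^sup>2) :: 'k) = of_real (2 * (norm x)\<^sup>2 + 2 * (norm y)\<^sup>2)"
    by (simp only: ip_self of_real_add of_real_mult of_real_numeral)
  then show ?thesis by (simp only: of_real_eq_iff)
qed

lemma ip_eqI:
  assumes "\<And>z. ip x z = ip y z"
  shows "x = y"
proof -
  have "ip (x - y) (x - y) = 0" using assms by (simp add: ip_diff_left)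
  then show ?thesis by (simp add: ip_self)
qed

text \<open>Subtracting the projection onto the line of \<open>y\<close> would lower the squared
  norm of \<open>x\<close> by a multiple of the squared modulus of \<open>ip x y\<close>; minimality
  permits no decrease.\<close>

lemma orthogonal_of_minimal:
  assumes "\<And>c. (norm x)\<^sup>2 \<le> (norm (x - scl c y))\<^sup>2"
  shows "ip y x = 0"
proof (cases "y = 0")
  case False
  have "(norm (ip x y))\<^sup>2 / (norm y)\<^sup>2 \<le> 0"
    using assms norm_diff_proj[OF False, of x] by (smt (verit))
  then have "ip x y = 0" using False by (simp add: divide_le_0_iff)
  then show ?thesis by (simp add: ip_commute[of x y])
qed simp

section \<open>Riesz representation\<close>

text \<open>The representing vector is a multiple of the element of least norm in the hyperplane \<open>f = 1\<close>.\<close>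

lemma riesz_representation:
  assumes "bounded_op scl (*) f"
  shows "\<exists>z. \<forall>x. f x = ip x z"
proof (cases "\<forall>x. f x = 0")
  case False
  interpret f: bounded_linear f using assms by (simp add: bounded_op_def)
  have f_scl: "f (scl c x) = c * f x" for c x using assms by (simp add: bounded_op_def)
  define C where "C = {x. f x = 1}"
  define D where "D = (INF x\<in>C. (norm x)\<^sup>2)"
  obtain w where "f w \<noteq> 0" using False by auto
  then have "scl (1 / f w) w \<in> C" by (simp add: C_def f_scl)
  then have C_ne: "C \<noteq> {}" by auto
  have bdd: "bdd_below ((\<lambda>x. (norm x)\<^sup>2) ` C)" by (auto intro!: bdd_belowI[of _ 0])
  have D_le: "D \<le> (norm x)\<^sup>2" if "x \<in> C" for x
    unfolding D_def using bdd that by (rule cINF_lower)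
  have "\<exists>x\<in>C. (norm x)\<^sup>2 < D + 1 / Suc n" for n
    using cINF_less_iff[OF C_ne bdd, of "D + 1 / Suc n"] by (simp add: D_def)
  then obtain X where X: "\<And>n. X n \<in> C" and X_less: "\<And>n. (norm (X n))\<^sup>2 < D + 1 / Suc n"
    by metis
  have dist_X: "(norm (X m - X n))\<^sup>2 \<le> 2 / Suc m + 2 / Suc n" for m n
  proof -
    \<comment> \<open>The midpoint stays in the hyperplane, so its squared norm is at least
      \<open>D\<close>; in the parallelogram law only the two excesses over \<open>D\<close>
      survive.\<close>
    have "(1/2) *\<^sub>R (X m + X n) \<in> C"
      using X[of m] X[of n] by (simp add: C_def f.add f.scaleR scaleR_2[symmetric])
    from D_le[OF this] have "4 * D \<le> (norm (X m + X n))\<^sup>2" by (simp add: power_divide)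
    moreover have "2 / real (Suc k) = 2 * (1 / Suc k)" for k by simp
    ultimately show ?thesis using parallelogram[of "X m" "X n"] X_less[of m] X_less[of n]
      by linarith
  qed
  have "Cauchy X"
  proof (rule metric_CauchyI)
    fix \<epsilon> :: real assume "\<epsilon> > 0"
    then obtain N where N: "inverse (real (Suc N)) < \<epsilon>\<^sup>2 / 4"
      using reals_Archimedean[of "\<epsilon>\<^sup>2 / 4"] by auto
    show "\<exists>N. \<forall>m\<ge>N. \<forall>n\<ge>N. dist (X m) (X n) < \<epsilon>"
    proof (intro exI allI impI)
      fix m n assume "m \<ge> N" "n \<ge> N"
      then have "2 / Suc m \<le> 2 / Suc N" "2 / Suc n \<le> 2 / Suc N" by (simp_all add: frac_le)
      then have "(norm (X m - X n))\<^sup>2 < \<epsilon>\<^sup>2"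
        using dist_X[of m n] N by (simp add: inverse_eq_divide)
      then show "dist (X m) (X n) < \<epsilon>"
        using \<open>\<epsilon> > 0\<close> by (simp add: dist_norm power_less_imp_less_base)
    qed
  qed
  then obtain z where z: "X \<longlonglongrightarrow> z" using Cauchy_convergent_iff convergent_def by blast
  have "(\<lambda>n. f (X n)) \<longlonglongrightarrow> f z" using z by (rule f.tendsto)
  then have fz: "f z = 1" using X by (simp add: C_def LIMSEQ_const_iff)
  have "(\<lambda>n. D + 1 / real (Suc n)) \<longlonglongrightarrow> D + 0"
    by (intro tendsto_intros LIMSEQ_Suc[OF lim_1_over_n])
  moreover have "(\<lambda>n. (norm (X n))\<^sup>2) \<longlonglongrightarrow> (norm z)\<^sup>2" by (intro tendsto_intros z)
  ultimately have z_le: "(norm z)\<^sup>2 \<le> D"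
    using X_less by (intro LIMSEQ_le) (auto intro: less_imp_le)
  \<comment> \<open>Because \<open>f z = 1\<close>, the vector \<open>x - scl (f x) z\<close> lies
    in the kernel of \<open>f\<close>. Moving \<open>z\<close> along it stays in \<open>C\<close>,
    so minimality of \<open>z\<close> forces orthogonality.\<close>
  have "ip x z = f x * ip z z" for x
  proof -
    have "ip (x - scl (f x) z) z = 0"
    proof (rule orthogonal_of_minimal)
      fix c
      have "z - scl c (x - scl (f x) z) \<in> C" by (simp add: C_def f.diff f_scl fz)
      then show "(norm z)\<^sup>2 \<le> (norm (z - scl c (x - scl (f x) z)))\<^sup>2"
        using D_le z_le order_trans by blast
    qed
    then show ?thesis by (simp add: ip_diff_left ip_scl_left)
  qed
  moreover have "z \<noteq> 0" using fz f.zero by auto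
  then have "of_real (1 / (norm z)\<^sup>2) * of_real ((norm z)\<^sup>2) = (1::'k)"
    unfolding of_real_mult[symmetric] by simp
  ultimately have "f x = ip x (scl (of_real (1 / (norm z)\<^sup>2)) z)" for x
    by (simp add: ip_scl_right ip_self del: of_real_power of_real_divide)
  then show ?thesis by blast
qed (auto intro: exI[of _ 0])

section \<open>Invertibility of coercive operators\<close>

text \<open>The step size \<open>t = a / K\<^sup>2\<close> minimizes the contraction factor \<open>1 - 2 t a + t\<^sup>2 K\<^sup>2\<close> of the squared norm.\<close>

lemma invertible_of_coercive:
  assumes S: "bounded_op scl scl S" and "a > 0"
    and coercive: "\<And>h. of_real (a * (norm h)\<^sup>2) \<le> ip (S h) h"
  shows "invertible_op scl S"
proof -
  interpret S: bounded_linear S using S by (simp add: bounded_op_def)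
  have S_scl: "S (scl c x) = scl c (S x)" for c x using S by (simp add: bounded_op_def)
  obtain K0 where K0: "K0 > 0" "\<And>h. norm (S h) \<le> norm h * K0" using S.pos_bounded by blast
  \<comment> \<open>Adding \<open>a\<close> to the bound gives \<open>a < K\<close> strictly, which
    keeps the radicand of \<open>q\<close> positive.\<close>
  define K where "K = K0 + a"
  have K: "norm (S h) \<le> K * norm h" for h
  proof -
    have "0 \<le> a * norm h" using \<open>a > 0\<close> by simp
    then show ?thesis using K0(2)[of h] by (simp add: K_def algebra_simps)
  qed
  have "0 < K" "a < K" using K0(1) \<open>a > 0\<close> by (simp_all add: K_def)
  define t where "t = a / K\<^sup>2"
  define q where "q = sqrt (1 - (a / K)\<^sup>2)"
  have aK: "0 < a / K" "a / K < 1" using \<open>0 < K\<close> \<open>a < K\<close> \<open>a > 0\<close> by simp_all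
  then have aK2: "0 < (a / K)\<^sup>2" "(a / K)\<^sup>2 < 1"
    using zero_less_power[OF aK(1), of 2] power_strict_mono[OF aK(2), of 2]
    by (simp_all only: power_one less_imp_le zero_less_numeral)
  have q: "0 \<le> q" "q < 1" "q\<^sup>2 = 1 - (a / K)\<^sup>2"
    using aK2 unfolding q_def by (simp_all only: real_sqrt_ge_0_iff real_sqrt_lt_1_iff real_sqrt_pow2)
  have "t > 0" using \<open>0 < K\<close> \<open>a > 0\<close> by (simp add: t_def)
  have contr: "norm (h - t *\<^sub>R S h) \<le> q * norm h" for h
  proof -
    \<comment> \<open>Since \<open>ip (S h) h\<close> is real, it equals \<open>ip h (S h)\<close>,
      and the two cross terms of the squared norm add up to \<open>- 2 * t * s\<close>.\<close>
    obtain s where s: "a * (norm h)\<^sup>2 \<le> s" "ip (S h) h = of_real s"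
      using coercive[of h] by (rule of_real_le_rcE)
    have s': "ip h (S h) = of_real s" by (simp add: ip_commute[of h "S h"] s)
    have "(of_real ((norm (h - t *\<^sub>R S h))\<^sup>2) :: 'k) = of_real ((norm h)\<^sup>2 - 2 * t * s + t\<^sup>2 * (norm (S h))\<^sup>2)"
      unfolding ip_self[symmetric] scl_of_real[symmetric]
      by (simp add: ip_diff_left ip_diff_right ip_scl_left ip_scl_right s s' algebra_simps power2_eq_square)
       (simp add: ip_self power2_eq_square)
    then have "(norm (h - t *\<^sub>R S h))\<^sup>2 = (norm h)\<^sup>2 - 2 * t * s + t\<^sup>2 * (norm (S h))\<^sup>2"
      by (simp only: of_real_eq_iff)
    also have "\<dots> \<le> (norm h)\<^sup>2 - 2 * t * (a * (norm h)\<^sup>2) + t\<^sup>2 * (K * norm h)\<^sup>2"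
      using s(1) \<open>t > 0\<close> K[of h]
      by (intro add_mono diff_mono mult_left_mono power_mono) simp_all
    also have "\<dots> = (1 - (a / K)\<^sup>2) * (norm h)\<^sup>2"
    proof -
      have "t * a = (a / K)\<^sup>2" by (simp add: t_def power2_eq_square)
      moreover have "t\<^sup>2 * K\<^sup>2 = (a / K)\<^sup>2"
        using \<open>0 < K\<close> by (simp add: t_def power_divide power2_eq_square)
      moreover have "(norm h)\<^sup>2 - 2 * t * (a * (norm h)\<^sup>2) + t\<^sup>2 * (K * norm h)\<^sup>2 =
          (1 - 2 * (t * a) + t\<^sup>2 * K\<^sup>2) * (norm h)\<^sup>2"
        by (simp add: power_mult_distrib algebra_simps)
      ultimately show ?thesis by simp
    qed
    also have "\<dots> = (q * norm h)\<^sup>2" by (simp add: q power_mult_distrib)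
    finally show ?thesis by (rule power2_le_imp_le) (simp add: q(1))
  qed
  have surj: "\<exists>x. S x = y" for y
  proof -
    have "\<exists>!x. x + t *\<^sub>R (y - S x) = x"
    proof (rule banach_fix_type)
      have "x + t *\<^sub>R (y - S x) - (x' + t *\<^sub>R (y - S x')) = (x - x') - t *\<^sub>R S (x - x')" for x x'
        by (simp add: S.diff scaleR_diff_right)
      with contr show "\<forall>x x'. dist (x + t *\<^sub>R (y - S x)) (x' + t *\<^sub>R (y - S x')) \<le> q * dist x x'"
        by (simp only: dist_norm simp_thms)
    qed (use q in auto)
    then obtain x where "x + t *\<^sub>R (y - S x) = x" by blast
    then show ?thesis using \<open>t > 0\<close> by auto
  qed
  \<comment> \<open>Cauchy-Schwarz turns coercivity into a lower bound on \<open>norm (S h)\<close>,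
    which gives both injectivity and the norm bound \<open>1 / a\<close> of the inverse.\<close>
  have lower: "a * norm h \<le> norm (S h)" for h
  proof (cases "h = 0")
    case False
    obtain s where "a * (norm h)\<^sup>2 \<le> s" "ip (S h) h = of_real s"
      using coercive[of h] by (rule of_real_le_rcE)
    then have "a * norm h * norm h \<le> norm (S h) * norm h"
      using Cauchy_Schwarz[of "S h" h] by (simp add: power2_eq_square)
    then show ?thesis using False by simp
  qed simp
  have inj: "x = y" if "S x = S y" for x y
    using lower[of "x - y"] that \<open>a > 0\<close> by (simp add: S.diff mult_le_0_iff)
  obtain R where R: "\<And>y. S (R y) = y" using surj by metis
  \<comment> \<open>The algebraic laws for \<open>R\<close> are checked after applying
    \<open>S\<close>, which is linear and injective.\<close>
  have "bounded_linear R"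
  proof (rule bounded_linear_intro[of _ "1 / a"])
    show "norm (R x) \<le> norm x * (1 / a)" for x
      using lower[of "R x"] \<open>a > 0\<close> by (simp add: R pos_le_divide_eq mult.commute)
  qed (rule inj, simp add: R S.add S.scaleR)+
  moreover have "R (scl c x) = scl c (R x)" for c x by (rule inj) (simp add: R S_scl)
  moreover have "R (S x) = x" for x by (rule inj) (simp add: R)
  ultimately have "bounded_op scl scl R \<and> S \<circ> R = id \<and> R \<circ> S = id"
    by (auto simp: bounded_op_def R)
  then show ?thesis unfolding invertible_op_def by blast
qed

section \<open>Expansion in an orthonormal basis and Parseval\<close>

text \<open>
  If \<open>y\<close> lies in the span of \<open>e ` F\<close>, then \<open>x - P F x = (x - y) - P F (x - y)\<close> has norm at most
  \<open>\<parallel>x - y\<parallel>\<close>, so density of the span gives convergence of the net of partial sums.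
\<close>

lemma has_sum_orthonormal_basis:
  assumes e: "orthonormal_basis scl ip I e"
  shows "((\<lambda>i. scl (ip x (e i)) (e i)) has_sum x) I"
proof -
  define P where "P F x = (\<Sum>i\<in>F. scl (ip x (e i)) (e i))" for F x
  have orth: "ip (e i) (e j) = (if i = j then 1 else 0)" if "i \<in> I" "j \<in> I" for i j
    using e that by (auto simp: orthonormal_basis_def)
  have P_ip: "ip (P F x) (e j) = ip x (e j)" if "finite F" "F \<subseteq> I" "j \<in> F" for F x j
  proof -
    have "ip (P F x) (e j) = (\<Sum>i\<in>F. if i = j then ip x (e i) else 0)"
      unfolding P_def ip_sum_left ip_scl_left
      by (intro sum.cong refl) (use that in \<open>simp add: orth subset_iff\<close>)
    then show ?thesis using that by simp
  qed
  have P_contr: "norm (x - P F x) \<le> norm x" if F: "finite F" "F \<subseteq> I" for F x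
  proof -
    \<comment> \<open>The residual is orthogonal to each \<open>e i\<close> with
      \<open>i \<in> F\<close>, hence to \<open>P F x\<close>, and Pythagoras bounds its norm by
      that of \<open>x\<close>.\<close>
    have "ip (e i) (x - P F x) = 0" if "i \<in> F" for i
      using P_ip[OF F that, of x]
      by (metis ip_commute ip_diff_left kcnj_0 right_minus_eq)
    then have "ip (P F x) (x - P F x) = 0"
      unfolding P_def[of F x] ip_sum_left ip_scl_left by (simp add: P_def[symmetric])
    then have o: "ip (P F x) (x - P F x) = 0" "ip (x - P F x) (P F x) = 0"
      by (simp_all add: ip_commute[of "P F x"])
    have "ip x x = ip ((x - P F x) + P F x) ((x - P F x) + P F x)" by simp
    also have "\<dots> = ip (x - P F x) (x - P F x) + ip (P F x) (P F x)"
      by (simp only: ip_add_left ip_add_right o add_0_left add_0_right)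
    finally have "(of_real ((norm x)\<^sup>2) :: 'k) = of_real ((norm (x - P F x))\<^sup>2 + (norm (P F x))\<^sup>2)"
      by (simp only: ip_self of_real_add)
    then have "(norm x)\<^sup>2 = (norm (x - P F x))\<^sup>2 + (norm (P F x))\<^sup>2" by (simp only: of_real_eq_iff)
    then show ?thesis by (simp add: power2_le_imp_le)
  qed
  have P_diff: "P F (x - y) = P F x - P F y" for F x y
    by (simp add: P_def ip_diff_left scale_left_diff_distrib sum_subtractf)
  have P_fix: "P F y = y" if F: "finite F" "F \<subseteq> I" and y: "y \<in> span (e ` F)" for F y
    using y
  proof (induction rule: span_induct_alt)
    case base
    then show ?case by (simp add: P_def)
  next
    case (step c x y)
    then obtain j where j: "j \<in> F" "x = e j" by auto
    have "P F x = (\<Sum>i\<in>F. if i = j then e j else 0)"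
      unfolding P_def by (intro sum.cong refl) (use j F in \<open>simp add: orth subset_iff\<close>)
    then have "P F x = x" using j F by simp
    moreover have "P F (scl c x + y) = scl c (P F x) + P F y"
      by (simp add: P_def ip_add_left ip_scl_left scale_left_distrib scale_sum_right sum.distrib)
    ultimately show ?case using step by simp
  qed
  have "\<forall>\<^sub>F F in finite_subsets_at_top I. dist (P F x) x < \<epsilon>" if "\<epsilon> > 0" for \<epsilon>
  proof -
    have "x \<in> closure (span (e ` I))" using e by (simp add: orthonormal_basis_def)
    then obtain y where y: "y \<in> span (e ` I)" "dist y x < \<epsilon>"
      using \<open>\<epsilon> > 0\<close> by (meson closure_approachable)
    obtain t r where t: "finite t" "t \<subseteq> e ` I" "y = (\<Sum>a\<in>t. scl (r a) a)"
      using y(1) unfolding span_explicit by auto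
    \<comment> \<open>Only finitely many basis vectors enter \<open>y\<close>; choosing indices for
      them gives a finite \<open>F0\<close> beyond which \<open>P F\<close> fixes
      \<open>y\<close>.\<close>
    obtain F0 where F0: "F0 \<subseteq> I" "finite F0" "t = e ` F0"
      using finite_subset_image[OF t(1,2)] by blast
    have "y \<in> span (e ` F0)" unfolding t(3) F0(3)[symmetric]
      by (intro span_sum span_scale span_base)
    show ?thesis
      unfolding eventually_finite_subsets_at_top
    proof (intro exI[of _ F0] conjI allI impI F0)
      fix F assume F: "finite F \<and> F0 \<subseteq> F \<and> F \<subseteq> I"
      then have "y \<in> span (e ` F)"
        using \<open>y \<in> span (e ` F0)\<close> span_mono[of "e ` F0" "e ` F"] by blast
      then have eq: "x - P F x = (x - y) - P F (x - y)" using F by (simp add: P_diff P_fix)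
      have "norm (x - P F x) \<le> norm (x - y)" unfolding eq using F by (intro P_contr) auto
      then show "dist (P F x) x < \<epsilon>" using y(2) by (simp add: dist_norm norm_minus_commute)
    qed
  qed
  then have "((\<lambda>F. P F x) \<longlongrightarrow> x) (finite_subsets_at_top I)" by (rule tendstoI)
  then show ?thesis unfolding has_sum_def P_def .
qed

text \<open>The continuous functional \<open>\<lambda>x. ip x y\<close> may be applied termwise to
  the expansion of \<open>x\<close>.\<close>

lemma has_sum_parseval:
  assumes "orthonormal_basis scl ip I e"
  shows "((\<lambda>i. ip x (e i) * ip (e i) y) has_sum ip x y) I"
  using has_sum_bounded_linear[OF bounded_linear_ip_left[of y] has_sum_orthonormal_basis[OF assms, of x]]
  by (simp add: ip_scl_left o_def)

text \<open>Parseval yields a limit in \<open>'k\<close>. The partial sums are nonnegative reals, so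
  taking norms carries the limit to \<open>ennreal\<close>, where the series is later
  integrated.\<close>

lemma infsum_ennreal_parseval:
  assumes "orthonormal_basis scl ip I e"
  shows "(\<Sum>\<^sub>\<infinity>i\<in>I. ennreal ((norm (ip x (e i)))\<^sup>2)) = ennreal ((norm x)\<^sup>2)"
proof -
  have "ip x (e i) * ip (e i) x = of_real ((norm (ip x (e i)))\<^sup>2)" for i
    by (simp add: ip_commute[of "e i" x] mult_kcnj scaleR_conv_of_real)
  then have "((\<lambda>i. of_real ((norm (ip x (e i)))\<^sup>2)) has_sum (of_real ((norm x)\<^sup>2) :: 'k)) I"
    using has_sum_parseval[OF assms, of x x] by (simp only: ip_self)
  then have "((\<lambda>F. of_real (\<Sum>i\<in>F. (norm (ip x (e i)))\<^sup>2)) \<longlongrightarrow> (of_real ((norm x)\<^sup>2) :: 'k))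
      (finite_subsets_at_top I)"
    by (simp add: has_sum_def del: of_real_power)
  then have "((\<lambda>F. ennreal (norm (of_real (\<Sum>i\<in>F. (norm (ip x (e i)))\<^sup>2) :: 'k))) \<longlongrightarrow>
      ennreal (norm (of_real ((norm x)\<^sup>2) :: 'k))) (finite_subsets_at_top I)"
    by (intro tendsto_ennrealI tendsto_norm)
  moreover have "norm (of_real (\<Sum>i\<in>F. (norm (ip x (e i)))\<^sup>2) :: 'k) = (\<Sum>i\<in>F. (norm (ip x (e i)))\<^sup>2)" for F
    unfolding norm_of_real by (simp add: sum_nonneg)
  moreover have "ennreal (\<Sum>i\<in>F. (norm (ip x (e i)))\<^sup>2) = (\<Sum>i\<in>F. ennreal ((norm (ip x (e i)))\<^sup>2))" for F
    by simp
  moreover have "norm (of_real ((norm x)\<^sup>2) :: 'k) = (norm x)\<^sup>2" unfolding norm_of_real by simp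
  ultimately have "((\<lambda>i. ennreal ((norm (ip x (e i)))\<^sup>2)) has_sum ennreal ((norm x)\<^sup>2)) I"
    unfolding has_sum_def by (simp only:)
  then show ?thesis by (rule infsumI)
qed

section \<open>Weak integrals\<close>

lemma has_weak_integral_unique:
  "has_weak_integral ip M F J \<Longrightarrow> has_weak_integral ip M F J' \<Longrightarrow> J = J'"
  by (auto simp: has_weak_integral_def intro!: ip_eqI)

lemma weak_integral_eqI: "has_weak_integral ip M F J \<Longrightarrow> weak_integral ip M F = J"
  unfolding weak_integral_def by (blast intro: has_weak_integral_unique)

lemma has_weak_integral_weak_integral:
  "weak_integrable ip M F \<Longrightarrow> has_weak_integral ip M F (weak_integral ip M F)"
  unfolding weak_integrable_def using weak_integral_eqI by auto

lemma has_weak_integral_add: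
  "has_weak_integral ip M F J \<Longrightarrow> has_weak_integral ip M F' J' \<Longrightarrow>
    has_weak_integral ip M (\<lambda>\<alpha>. F \<alpha> + F' \<alpha>) (J + J')"
  by (simp add: has_weak_integral_def ip_add_left)

lemma has_weak_integral_scl:
  "has_weak_integral ip M F J \<Longrightarrow> has_weak_integral ip M (\<lambda>\<alpha>. scl c (F \<alpha>)) (scl c J)"
  by (simp add: has_weak_integral_def ip_scl_left)

end

text \<open>Operators and bases are controlled only on \<open>space M\<close>, so identities between
  integrands are available only there.\<close>

lemma has_weak_integral_cong:
  assumes "\<And>\<alpha>. \<alpha> \<in> space M \<Longrightarrow> F \<alpha> = G \<alpha>"
  shows "has_weak_integral ip M F J \<longleftrightarrow> has_weak_integral ip M G J"
proof -
  have "integrable M (\<lambda>\<alpha>. ip (F \<alpha>) g) \<longleftrightarrow> integrable M (\<lambda>\<alpha>. ip (G \<alpha>) g)" for g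
    by (rule Bochner_Integration.integrable_cong) (simp_all add: assms)
  moreover have "(\<integral>\<alpha>. ip (F \<alpha>) g \<partial>M) = (\<integral>\<alpha>. ip (G \<alpha>) g \<partial>M)" for g
    by (rule Bochner_Integration.integral_cong) (simp_all add: assms)
  ultimately show ?thesis by (simp add: has_weak_integral_def)
qed

section \<open>Adjoints of operators between two Hilbert spaces\<close>

locale hilbert_space_pair = H: hilbert_space scl ip + H0: hilbert_space scl0 ip0
  for scl :: "'k::rc_scalar \<Rightarrow> 'h::banach \<Rightarrow> 'h" and ip :: "'h \<Rightarrow> 'h \<Rightarrow> 'k"
    and scl0 :: "'k \<Rightarrow> 'g::banach \<Rightarrow> 'g" and ip0 :: "'g \<Rightarrow> 'g \<Rightarrow> 'k"
begin

text \<open>\<open>adj\<close> is a definite description, so existence and uniqueness are both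
  required. Riesz applied to \<open>\<lambda>x. ip0 (B x) y\<close> gives existence for each
  \<open>y\<close>; nondegeneracy of \<open>ip\<close> gives uniqueness.\<close>

lemma ip_adj:
  assumes B: "bounded_op scl scl0 B"
  shows "ip x (adj ip ip0 B y) = ip0 (B x) y"
proof -
  have "\<exists>z. \<forall>x. ip0 (B x) y = ip x z" for y
  proof (rule H.riesz_representation)
    show "bounded_op scl (*) (\<lambda>x. ip0 (B x) y)"
      using B bounded_linear_compose[OF H0.bounded_linear_ip_left[of y], of B]
      by (simp add: bounded_op_def H0.ip_scl_left)
  qed
  then obtain C where C: "\<And>x y. ip0 (B x) y = ip x (C y)" by metis
  have "\<exists>!C. \<forall>x y. ip0 (B x) y = ip x (C y)"
  proof (rule ex1I[of _ C])
    fix D assume D: "\<forall>x y. ip0 (B x) y = ip x (D y)"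
    show "D = C"
    proof
      fix y
      have "ip (D y) x = ip (C y) x" for x
        using C[of x y] D by (metis H.ip_commute)
      then show "D y = C y" by (rule H.ip_eqI)
    qed
  qed (use C in blast)
  then have "\<forall>x y. ip0 (B x) y = ip x (adj ip ip0 B y)"
    unfolding adj_def by (rule theI')
  then show ?thesis by simp
qed

lemma ip_adj_left:
  assumes "bounded_op scl scl0 B"
  shows "ip (adj ip ip0 B y) x = ip0 y (B x)"
  using ip_adj[OF assms, of x y] by (metis H.ip_commute H0.ip_commute)

lemma bounded_op_adj:
  assumes B: "bounded_op scl scl0 B"
  shows "bounded_op scl0 scl (adj ip ip0 B)"
proof -
  let ?C = "adj ip ip0 B"
  obtain K where K: "0 \<le> K" "\<And>x. norm (B x) \<le> norm x * K"
    using B bounded_linear.nonneg_bounded unfolding bounded_op_def by blast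
  have C_scl: "?C (scl0 c x) = scl c (?C x)" for c x
    by (rule H.ip_eqI) (simp add: ip_adj_left[OF B] H.ip_scl_left H0.ip_scl_left)
  have "bounded_linear ?C"
  proof (rule bounded_linear_intro[of _ K])
    show "?C (x + y) = ?C x + ?C y" for x y
      by (rule H.ip_eqI) (simp add: ip_adj_left[OF B] H.ip_add_left H0.ip_add_left)
    show "?C (r *\<^sub>R x) = r *\<^sub>R ?C x" for r x
      using C_scl[of "of_real r" x] by (simp add: H.scl_of_real H0.scl_of_real)
    show "norm (?C y) \<le> norm y * K" for y
    proof (cases "?C y = 0")
      case False
      \<comment> \<open>The squared norm is the modulus of \<open>ip0 y (B (?C y))\<close>. One
        factor \<open>norm (?C y)\<close> is cancelled at the end, hence the case split.\<close>
      have "(norm (?C y))\<^sup>2 = norm (ip (?C y) (?C y))"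
        unfolding H.ip_self norm_of_real by simp
      also have "\<dots> \<le> norm y * norm (B (?C y))"
        unfolding ip_adj_left[OF B] by (rule H0.Cauchy_Schwarz)
      also have "\<dots> \<le> norm y * (norm (?C y) * K)" by (intro mult_left_mono K) simp
      finally show ?thesis using False by (simp add: power2_eq_square)
    qed (use K(1) in simp)
  qed
  then show ?thesis by (simp add: bounded_op_def C_scl)
qed

section \<open>Series formed with the adjoint images of a basis\<close>

lemma infsum_adj_basis:
  assumes B: "bounded_op scl scl0 B" and e: "orthonormal_basis scl0 ip0 I e"
  shows "(\<Sum>\<^sub>\<infinity>\<beta>\<in>I. scl0 (ip h (adj ip ip0 B (e \<beta>))) (e \<beta>)) = B h"
  unfolding ip_adj[OF B] by (rule infsumI[OF H0.has_sum_orthonormal_basis[OF e]])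

lemma infsum_norm_adj_basis:
  assumes B: "bounded_op scl scl0 B" and e: "orthonormal_basis scl0 ip0 I e"
  shows "(\<Sum>\<^sub>\<infinity>\<beta>\<in>I. ennreal ((norm (ip h (adj ip ip0 B (e \<beta>))))\<^sup>2)) = ennreal ((norm (B h))\<^sup>2)"
  unfolding ip_adj[OF B] by (rule H0.infsum_ennreal_parseval[OF e])

text \<open>The coefficients of \<open>h\<close> against \<open>adj ip ip0 B (e \<beta>)\<close> are
  those of \<open>B h\<close> in the basis, and the bounded operator \<open>adj ip ip0 C\<close>
  acts on the expansion term by term.\<close>

lemma infsum_adj_adj_basis:
  assumes B: "bounded_op scl scl0 B" and C: "bounded_op scl scl0 C"
    and e: "orthonormal_basis scl0 ip0 I e"
  shows "(\<Sum>\<^sub>\<infinity>\<beta>\<in>I. scl (ip h (adj ip ip0 B (e \<beta>))) (adj ip ip0 C (e \<beta>))) = adj ip ip0 C (B h)"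
proof (rule infsumI)
  have "bounded_linear (adj ip ip0 C)" and "\<And>c x. adj ip ip0 C (scl0 c x) = scl c (adj ip ip0 C x)"
    using bounded_op_adj[OF C] by (simp_all add: bounded_op_def)
  then show "((\<lambda>\<beta>. scl (ip h (adj ip ip0 B (e \<beta>))) (adj ip ip0 C (e \<beta>))) has_sum adj ip ip0 C (B h)) I"
    using has_sum_bounded_linear[OF _ H0.has_sum_orthonormal_basis[OF e, of "B h"], of "adj ip ip0 C"]
    by (simp add: ip_adj[OF B])
qed

lemma infsum_ip_adj_basis:
  assumes B: "bounded_op scl scl0 B" and C: "bounded_op scl scl0 C"
    and e: "orthonormal_basis scl0 ip0 I e"
  shows "(\<Sum>\<^sub>\<infinity>\<beta>\<in>I. ip h (adj ip ip0 B (e \<beta>)) * ip (adj ip ip0 C (e \<beta>)) h) = ip0 (B h) (C h)"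
  unfolding ip_adj[OF B] ip_adj_left[OF C] by (rule infsumI[OF H0.has_sum_parseval[OF e]])

section \<open>Boundedness of the analysis operators\<close>

text \<open>Linearity holds pointwise. Square integrability and the norm bound merge into one
  estimate of a nonnegative integral, because its finiteness already makes the measurable integrand
  integrable.\<close>

lemma bounded_op_L2_analysis_op_iff:
  assumes B: "\<And>\<alpha>. \<alpha> \<in> space M \<Longrightarrow> bounded_op scl scl0 (B \<alpha>)"
    and meas: "\<And>h. (\<lambda>\<alpha>. B \<alpha> h) \<in> borel_measurable M"
  shows "bounded_op_L2 scl scl0 M (analysis_op B) \<longleftrightarrow>
    (\<exists>c>0. \<forall>h. (\<integral>\<^sup>+\<alpha>. ennreal ((norm (B \<alpha> h))\<^sup>2) \<partial>M) \<le> ennreal (c * (norm h)\<^sup>2))"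
    (is "_ \<longleftrightarrow> (\<exists>c>0. \<forall>h. ?N h \<le> _)")
proof
  assume L2: "bounded_op_L2 scl scl0 M (analysis_op B)"
  then obtain C where C: "\<And>h. norm_L2 M (analysis_op B h) \<le> C * norm h"
    unfolding bounded_op_L2_def by blast
  \<comment> \<open>The summand \<open>1\<close> makes the constant strictly positive even when
    \<open>C = 0\<close>.\<close>
  show "\<exists>c>0. \<forall>h. ?N h \<le> ennreal (c * (norm h)\<^sup>2)"
  proof (intro exI[of _ "C\<^sup>2 + 1"] conjI allI)
    fix h
    have int: "integrable M (\<lambda>\<alpha>. (norm (B \<alpha> h))\<^sup>2)"
      using L2 by (simp add: bounded_op_L2_def sq_integrable_def analysis_op_def)
    have nonneg: "0 \<le> (\<integral>\<alpha>. (norm (B \<alpha> h))\<^sup>2 \<partial>M)" by simp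
    have le: "sqrt (\<integral>\<alpha>. (norm (B \<alpha> h))\<^sup>2 \<partial>M) \<le> C * norm h"
      using C[of h] by (simp add: norm_L2_def analysis_op_def)
    have "(\<integral>\<alpha>. (norm (B \<alpha> h))\<^sup>2 \<partial>M) = (sqrt (\<integral>\<alpha>. (norm (B \<alpha> h))\<^sup>2 \<partial>M))\<^sup>2"
      using nonneg by simp
    also have "\<dots> \<le> (C * norm h)\<^sup>2" using le nonneg by (intro power_mono) simp_all
    also have "\<dots> \<le> (C\<^sup>2 + 1) * (norm h)\<^sup>2" by (simp add: power_mult_distrib algebra_simps)
    finally show "?N h \<le> ennreal ((C\<^sup>2 + 1) * (norm h)\<^sup>2)"
      using int by (simp add: nn_integral_eq_integral ennreal_leI)
  qed (simp add: add_nonneg_pos)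
next
  assume "\<exists>c>0. \<forall>h. ?N h \<le> ennreal (c * (norm h)\<^sup>2)"
  then obtain c where c: "c > 0" "\<And>h. ?N h \<le> ennreal (c * (norm h)\<^sup>2)" by blast
  have int: "integrable M (\<lambda>\<alpha>. (norm (B \<alpha> h))\<^sup>2)" for h
  proof (rule integrableI_nonneg)
    show "(\<lambda>\<alpha>. (norm (B \<alpha> h))\<^sup>2) \<in> borel_measurable M"
      using meas[of h] by measurable
    show "?N h < \<infinity>" using c(2)[of h] by (simp add: le_less_trans)
  qed simp
  have "norm_L2 M (analysis_op B h) \<le> sqrt c * norm h" for h
  proof -
    have "ennreal (\<integral>\<alpha>. (norm (B \<alpha> h))\<^sup>2 \<partial>M) \<le> ennreal (c * (norm h)\<^sup>2)"
      using c(2)[of h] int[of h] by (simp add: nn_integral_eq_integral)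
    then have "(\<integral>\<alpha>. (norm (B \<alpha> h))\<^sup>2 \<partial>M) \<le> c * (norm h)\<^sup>2"
      using c(1) by (simp add: ennreal_le_iff)
    then have "sqrt (\<integral>\<alpha>. (norm (B \<alpha> h))\<^sup>2 \<partial>M) \<le> sqrt (c * (norm h)\<^sup>2)"
      by (rule real_sqrt_le_mono)
    then show ?thesis by (simp add: norm_L2_def analysis_op_def real_sqrt_mult)
  qed
  moreover have "AE \<alpha> in M. B \<alpha> (x + y) = B \<alpha> x + B \<alpha> y" for x y
    by (rule AE_I2) (use B in \<open>simp add: bounded_op_def linear_simps\<close>)
  moreover have "AE \<alpha> in M. B \<alpha> (scl c x) = scl0 c (B \<alpha> x)" for c x
    by (rule AE_I2) (use B in \<open>simp add: bounded_op_def\<close>)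
  ultimately show "bounded_op_L2 scl scl0 M (analysis_op B)"
    unfolding bounded_op_L2_def sq_integrable_def using meas int by (auto simp: analysis_op_def)
qed

section \<open>Operator conditions versus scalar conditions on the frame operator\<close>

text \<open>The bridge from (i) and (ii) to (iii) and (iv). Allowing \<open>0 \<le> a\<close> serves
  frames with \<open>a > 0\<close> and Bessel pairs with \<open>a = 0\<close> at once. Symmetry of
  \<open>S\<close> corresponds to equality with the frame operator of the swapped pair.\<close>

lemma frame_op_conditions_iff:
  assumes A: "\<forall>\<alpha>\<in>space M. bounded_op scl scl0 (A \<alpha>)"
    and \<Psi>: "\<forall>\<alpha>\<in>space M. bounded_op scl scl0 (\<Psi> \<alpha>)" and "0 \<le> a"
  defines "S \<equiv> frame_op ip ip0 M A \<Psi>"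
  shows "(\<forall>h. weak_integrable ip M (\<lambda>\<alpha>. adj ip ip0 (\<Psi> \<alpha>) (A \<alpha> h))) \<and>
      bounded_op scl scl S \<and> positive_op ip S \<and> op_bounds ip S a b \<longleftrightarrow>
    (\<exists>r>0. \<forall>h. weak_integrable ip M (\<lambda>\<alpha>. adj ip ip0 (\<Psi> \<alpha>) (A \<alpha> h)) \<and>
      weak_integrable ip M (\<lambda>\<alpha>. adj ip ip0 (A \<alpha>) (\<Psi> \<alpha> h)) \<and>
      integrable M (\<lambda>\<alpha>. ip0 (A \<alpha> h) (\<Psi> \<alpha> h)) \<and> norm (S h) \<le> r * norm h \<and>
      S h = frame_op ip ip0 M \<Psi> A h \<and>
      of_real (a * (norm h)\<^sup>2) \<le> (\<integral>\<alpha>. ip0 (A \<alpha> h) (\<Psi> \<alpha> h) \<partial>M) \<and>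
      (\<integral>\<alpha>. ip0 (A \<alpha> h) (\<Psi> \<alpha> h) \<partial>M) \<le> of_real (b * (norm h)\<^sup>2))"
    (is "?L \<longleftrightarrow> ?R")
proof -
  \<comment> \<open>Moving the adjoint to the other argument turns weak integration into a family of
    scalar integrals, symmetric in \<open>B\<close> and \<open>C\<close> up to conjugation.\<close>
  have weak_iff: "has_weak_integral ip M (\<lambda>\<alpha>. adj ip ip0 (C \<alpha>) (B \<alpha> h)) J \<longleftrightarrow>
      (\<forall>g. integrable M (\<lambda>\<alpha>. ip0 (B \<alpha> h) (C \<alpha> g)) \<and> ip J g = (\<integral>\<alpha>. ip0 (B \<alpha> h) (C \<alpha> g) \<partial>M))"
    if C: "\<forall>\<alpha>\<in>space M. bounded_op scl scl0 (C \<alpha>)" for B C :: "'a \<Rightarrow> 'h \<Rightarrow> 'g" and h J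
  proof -
    have "integrable M (\<lambda>\<alpha>. ip (adj ip ip0 (C \<alpha>) (B \<alpha> h)) g) \<longleftrightarrow>
        integrable M (\<lambda>\<alpha>. ip0 (B \<alpha> h) (C \<alpha> g))" for g
      by (rule Bochner_Integration.integrable_cong) (simp_all add: ip_adj_left C)
    moreover have "(\<integral>\<alpha>. ip (adj ip ip0 (C \<alpha>) (B \<alpha> h)) g \<partial>M) = (\<integral>\<alpha>. ip0 (B \<alpha> h) (C \<alpha> g) \<partial>M)" for g
      by (rule Bochner_Integration.integral_cong) (simp_all add: ip_adj_left C)
    ultimately show ?thesis by (simp add: has_weak_integral_def)
  qed
  have frame: "integrable M (\<lambda>\<alpha>. ip0 (B \<alpha> h) (C \<alpha> g))"
      "ip (frame_op ip ip0 M B C h) g = (\<integral>\<alpha>. ip0 (B \<alpha> h) (C \<alpha> g) \<partial>M)"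
    if "\<forall>\<alpha>\<in>space M. bounded_op scl scl0 (C \<alpha>)"
      and "weak_integrable ip M (\<lambda>\<alpha>. adj ip ip0 (C \<alpha>) (B \<alpha> h))" for B C :: "'a \<Rightarrow> 'h \<Rightarrow> 'g" and h g
    using H.has_weak_integral_weak_integral[OF that(2)]
    unfolding weak_iff[where B = B and h = h, OF that(1)]
    by (simp_all add: frame_op_def)
  have swap: "integrable M (\<lambda>\<alpha>. ip0 (C \<alpha> g) (B \<alpha> h))"
      "(\<integral>\<alpha>. ip0 (C \<alpha> g) (B \<alpha> h) \<partial>M) = kcnj (\<integral>\<alpha>. ip0 (B \<alpha> h) (C \<alpha> g) \<partial>M)"
    if "integrable M (\<lambda>\<alpha>. ip0 (B \<alpha> h) (C \<alpha> g))" for B C :: "'a \<Rightarrow> 'h \<Rightarrow> 'g" and h g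
    using integrable_bounded_linear[OF bounded_linear_kcnj that]
      integral_bounded_linear[OF bounded_linear_kcnj that]
    by (simp_all add: H0.ip_commute[of "B _ h"])
  show ?thesis
  proof
    assume ?L
    then have wi: "\<And>h. weak_integrable ip M (\<lambda>\<alpha>. adj ip ip0 (\<Psi> \<alpha>) (A \<alpha> h))"
      and lin: "bounded_linear S" and pos: "positive_op ip S" and bnd: "op_bounds ip S a b"
      by (simp_all add: bounded_op_def)
    note S = frame[where B = A, OF \<Psi> wi, folded S_def]
    obtain r where r: "r > 0" "\<And>h. norm (S h) \<le> norm h * r"
      using bounded_linear.pos_bounded[OF lin] by blast
    \<comment> \<open>By symmetry, \<open>S h\<close> has the inner products required of a weak
      integral for the swapped pair; this yields existence of that integral as well as its
      value.\<close>
    have S': "has_weak_integral ip M (\<lambda>\<alpha>. adj ip ip0 (A \<alpha>) (\<Psi> \<alpha> h)) (S h)" for h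
      unfolding weak_iff[where B = \<Psi> and h = h, OF A]
    proof (intro allI conjI)
      fix g
      show "integrable M (\<lambda>\<alpha>. ip0 (\<Psi> \<alpha> h) (A \<alpha> g))" by (rule swap(1)[where B = A and C = \<Psi>, OF S(1)])
      have "ip (S h) g = ip h (S g)" using pos by (simp add: positive_op_def)
      also have "\<dots> = kcnj (ip (S g) h)" by (rule H.ip_commute)
      also have "\<dots> = (\<integral>\<alpha>. ip0 (\<Psi> \<alpha> h) (A \<alpha> g) \<partial>M)" unfolding S(2) swap(2)[where B = A and C = \<Psi>, OF S(1)] ..
      finally show "ip (S h) g = (\<integral>\<alpha>. ip0 (\<Psi> \<alpha> h) (A \<alpha> g) \<partial>M)" .
    qed
    have "weak_integrable ip M (\<lambda>\<alpha>. adj ip ip0 (A \<alpha>) (\<Psi> \<alpha> h))" for h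
      using S' unfolding weak_integrable_def by blast
    moreover have "S h = frame_op ip ip0 M \<Psi> A h" for h
      unfolding frame_op_def using H.weak_integral_eqI[OF S'] by simp
    moreover have "norm (S h) \<le> r * norm h" for h using r(2)[of h] by (simp add: mult.commute)
    ultimately show ?R using wi r(1) S(1) bnd unfolding op_bounds_def S(2) by blast
  next
    assume ?R
    then obtain r where "r > 0"
      and wi: "\<And>h. weak_integrable ip M (\<lambda>\<alpha>. adj ip ip0 (\<Psi> \<alpha>) (A \<alpha> h))"
      and wi': "\<And>h. weak_integrable ip M (\<lambda>\<alpha>. adj ip ip0 (A \<alpha>) (\<Psi> \<alpha> h))"
      and bound: "\<And>h. norm (S h) \<le> r * norm h"
      and eq: "\<And>h. S h = frame_op ip ip0 M \<Psi> A h"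
      and lower: "\<And>h. of_real (a * (norm h)\<^sup>2) \<le> (\<integral>\<alpha>. ip0 (A \<alpha> h) (\<Psi> \<alpha> h) \<partial>M)"
      and upper: "\<And>h. (\<integral>\<alpha>. ip0 (A \<alpha> h) (\<Psi> \<alpha> h) \<partial>M) \<le> of_real (b * (norm h)\<^sup>2)"
      by blast
    note S = frame[where B = A, OF \<Psi> wi, folded S_def] and S' = frame[where B = \<Psi>, OF A wi', folded eq]
    have bounds: "op_bounds ip S a b" using lower upper by (simp add: op_bounds_def S(2))
    have S_weak: "has_weak_integral ip M (\<lambda>\<alpha>. adj ip ip0 (\<Psi> \<alpha>) (A \<alpha> h)) (S h)" for h
      using S weak_iff[where B = A and h = h, OF \<Psi>] by blast
    \<comment> \<open>As \<open>S\<close> is given by a definite description, linearity comes from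
      uniqueness: \<open>S x + S y\<close> is also a weak integral of the integrand for
      \<open>x + y\<close>.\<close>
    have S_add: "S (x + y) = S x + S y" for x y
    proof (rule H.has_weak_integral_unique[OF S_weak])
      have "adj ip ip0 (\<Psi> \<alpha>) (A \<alpha> (x + y)) = adj ip ip0 (\<Psi> \<alpha>) (A \<alpha> x) + adj ip ip0 (\<Psi> \<alpha>) (A \<alpha> y)"
        if "\<alpha> \<in> space M" for \<alpha>
        using bspec[OF A that] bounded_op_adj[OF bspec[OF \<Psi> that]] by (simp add: bounded_op_def linear_simps)
      then show "has_weak_integral ip M (\<lambda>\<alpha>. adj ip ip0 (\<Psi> \<alpha>) (A \<alpha> (x + y))) (S x + S y)"
        using H.has_weak_integral_add[OF S_weak[of x] S_weak[of y]] by (simp cong: has_weak_integral_cong)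
    qed
    have S_scl: "S (scl c x) = scl c (S x)" for c x
    proof (rule H.has_weak_integral_unique[OF S_weak])
      have "adj ip ip0 (\<Psi> \<alpha>) (A \<alpha> (scl c x)) = scl c (adj ip ip0 (\<Psi> \<alpha>) (A \<alpha> x))"
        if "\<alpha> \<in> space M" for \<alpha>
        using bspec[OF A that] bounded_op_adj[OF bspec[OF \<Psi> that]] by (simp add: bounded_op_def)
      then show "has_weak_integral ip M (\<lambda>\<alpha>. adj ip ip0 (\<Psi> \<alpha>) (A \<alpha> (scl c x))) (scl c (S x))"
        using H.has_weak_integral_scl[OF S_weak[of x], of c] by (simp cong: has_weak_integral_cong)
    qed
    have "bounded_linear S"
    proof (rule bounded_linear_intro[of _ r])
      show "S (t *\<^sub>R x) = t *\<^sub>R S x" for t x using S_scl[of "of_real t"] by (simp add: H.scl_of_real)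
      show "norm (S x) \<le> norm x * r" for x using bound[of x] by (simp add: mult.commute)
    qed (rule S_add)
    then have op: "bounded_op scl scl S" by (simp add: bounded_op_def S_scl)
    \<comment> \<open>The equality of the two weak integrals enters through \<open>S'\<close>, which
      evaluates \<open>S x\<close> by the swapped pair; conjugating that integral leads to
      \<open>S y\<close>.\<close>
    have "ip (S x) y = ip x (S y)" for x y
    proof -
      have "ip (S x) y = (\<integral>\<alpha>. ip0 (\<Psi> \<alpha> x) (A \<alpha> y) \<partial>M)" by (rule S')
      also have "\<dots> = kcnj (ip (S y) x)" unfolding S(2) by (rule swap(2)[where B = A and C = \<Psi>, OF S(1)])
      also have "\<dots> = ip x (S y)" by (rule H.ip_commute[symmetric])
      finally show ?thesis .
    qed
    moreover have "0 \<le> ip (S x) x" for x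
    proof -
      obtain s where s: "a * (norm x)\<^sup>2 \<le> s" "ip (S x) x = of_real s"
        using lower[of x] unfolding S(2)[symmetric] by (rule of_real_le_rcE)
      have "0 \<le> a * (norm x)\<^sup>2" using \<open>0 \<le> a\<close> by simp
      then have "(of_real 0 :: 'k) \<le> of_real s" using s(1) by (simp only: of_real_le_rc_iff)
      then show ?thesis by (simp add: s(2))
    qed
    ultimately show ?L using wi op bounds by (simp add: positive_op_def)
  qed
qed

end

section \<open>The four equivalences\<close>

theorem theorem3p2:
  fixes scl :: "'k::rc_scalar \<Rightarrow> 'h::banach \<Rightarrow> 'h" and ip :: "'h \<Rightarrow> 'h \<Rightarrow> 'k"
    and scl0 :: "'k \<Rightarrow> 'g::banach \<Rightarrow> 'g" and ip0 :: "'g \<Rightarrow> 'g \<Rightarrow> 'k"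
    and M :: "'a measure"
    and A \<Psi> :: "'a \<Rightarrow> 'h \<Rightarrow> 'g"
    and I :: "'a \<Rightarrow> 'b set" and e :: "'a \<Rightarrow> 'b \<Rightarrow> 'g"
    and u v :: "'a \<Rightarrow> 'b \<Rightarrow> 'h"
    and T :: "'h \<Rightarrow> 'h" and cond_M :: bool and cond_B :: "real \<Rightarrow> real \<Rightarrow> bool"
  assumes H: "hilbert_space scl ip" and H0: "hilbert_space scl0 ip0"
    and A: "\<And>\<alpha>. \<alpha> \<in> space M \<Longrightarrow> bounded_op scl scl0 (A \<alpha>)"
    and \<Psi>: "\<And>\<alpha>. \<alpha> \<in> space M \<Longrightarrow> bounded_op scl scl0 (\<Psi> \<alpha>)"
    and e: "\<And>\<alpha>. \<alpha> \<in> space M \<Longrightarrow> orthonormal_basis scl0 ip0 (I \<alpha>) (e \<alpha>)"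
    and u: "\<And>\<alpha> \<beta>. \<alpha> \<in> space M \<Longrightarrow> \<beta> \<in> I \<alpha> \<Longrightarrow> u \<alpha> \<beta> = adj ip ip0 (A \<alpha>) (e \<alpha> \<beta>)"
    and v: "\<And>\<alpha> \<beta>. \<alpha> \<in> space M \<Longrightarrow> \<beta> \<in> I \<alpha> \<Longrightarrow> v \<alpha> \<beta> = adj ip ip0 (\<Psi> \<alpha>) (e \<alpha> \<beta>)"
    and cond_M: "cond_M \<longleftrightarrow>
      (\<forall>h. (\<lambda>\<alpha>. \<Sum>\<^sub>\<infinity>\<beta>\<in>I \<alpha>. scl0 (ip h (u \<alpha> \<beta>)) (e \<alpha> \<beta>)) \<in> borel_measurable M \<and>
           (\<lambda>\<alpha>. \<Sum>\<^sub>\<infinity>\<beta>\<in>I \<alpha>. scl0 (ip h (v \<alpha> \<beta>)) (e \<alpha> \<beta>)) \<in> borel_measurable M)"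
    and cond_B: "\<And>c d. cond_B c d \<longleftrightarrow>
      (\<forall>h. (\<integral>\<^sup>+\<alpha>. (\<Sum>\<^sub>\<infinity>\<beta>\<in>I \<alpha>. ennreal ((norm (ip h (u \<alpha> \<beta>)))\<^sup>2)) \<partial>M) \<le> ennreal (c * (norm h)\<^sup>2) \<and>
           (\<integral>\<^sup>+\<alpha>. (\<Sum>\<^sub>\<infinity>\<beta>\<in>I \<alpha>. ennreal ((norm (ip h (v \<alpha> \<beta>)))\<^sup>2)) \<partial>M) \<le> ennreal (d * (norm h)\<^sup>2))"
    and T: "\<And>h. T h = weak_integral ip M (\<lambda>\<alpha>. \<Sum>\<^sub>\<infinity>\<beta>\<in>I \<alpha>. scl (ip h (u \<alpha> \<beta>)) (v \<alpha> \<beta>))"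
  shows
    "(\<forall>a>0. \<forall>b>0. continuous_ov_frame_bounds scl ip scl0 ip0 M A \<Psi> a b \<longleftrightarrow>
        cond_M \<and>
        (\<exists>c>0. \<exists>d>0.
          (\<forall>h. weak_integrable ip M (\<lambda>\<alpha>. \<Sum>\<^sub>\<infinity>\<beta>\<in>I \<alpha>. scl (ip h (u \<alpha> \<beta>)) (v \<alpha> \<beta>))) \<and>
          bounded_op scl scl T \<and> positive_op ip T \<and> invertible_op scl T \<and>
          (\<forall>h. of_real (a * (norm h)\<^sup>2) \<le> ip (T h) h \<and> ip (T h) h \<le> of_real (b * (norm h)\<^sup>2)) \<and>
          cond_B c d)) \<and>
     (\<forall>b. continuous_bessel_bound scl ip scl0 ip0 M A \<Psi> b \<longleftrightarrow>
        cond_M \<and>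
        (\<exists>c>0. \<exists>d>0.
          (\<forall>h. weak_integrable ip M (\<lambda>\<alpha>. \<Sum>\<^sub>\<infinity>\<beta>\<in>I \<alpha>. scl (ip h (u \<alpha> \<beta>)) (v \<alpha> \<beta>))) \<and>
          bounded_op scl scl T \<and> positive_op ip T \<and>
          (\<forall>h. 0 \<le> ip (T h) h \<and> ip (T h) h \<le> of_real (b * (norm h)\<^sup>2)) \<and>
          cond_B c d)) \<and>
     (\<forall>a>0. \<forall>b>0. continuous_ov_frame_bounds scl ip scl0 ip0 M A \<Psi> a b \<longleftrightarrow>
        cond_M \<and>
        (\<exists>c>0. \<exists>d>0. \<exists>r>0.
          (\<forall>h.
            weak_integrable ip M (\<lambda>\<alpha>. \<Sum>\<^sub>\<infinity>\<beta>\<in>I \<alpha>. scl (ip h (u \<alpha> \<beta>)) (v \<alpha> \<beta>)) \<and>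
            weak_integrable ip M (\<lambda>\<alpha>. \<Sum>\<^sub>\<infinity>\<beta>\<in>I \<alpha>. scl (ip h (v \<alpha> \<beta>)) (u \<alpha> \<beta>)) \<and>
            integrable M (\<lambda>\<alpha>. \<Sum>\<^sub>\<infinity>\<beta>\<in>I \<alpha>. ip h (u \<alpha> \<beta>) * ip (v \<alpha> \<beta>) h) \<and>
            norm (weak_integral ip M (\<lambda>\<alpha>. \<Sum>\<^sub>\<infinity>\<beta>\<in>I \<alpha>. scl (ip h (u \<alpha> \<beta>)) (v \<alpha> \<beta>))) \<le> r * norm h \<and>
            weak_integral ip M (\<lambda>\<alpha>. \<Sum>\<^sub>\<infinity>\<beta>\<in>I \<alpha>. scl (ip h (u \<alpha> \<beta>)) (v \<alpha> \<beta>)) =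
              weak_integral ip M (\<lambda>\<alpha>. \<Sum>\<^sub>\<infinity>\<beta>\<in>I \<alpha>. scl (ip h (v \<alpha> \<beta>)) (u \<alpha> \<beta>)) \<and>
            of_real (a * (norm h)\<^sup>2) \<le> (\<integral>\<alpha>. (\<Sum>\<^sub>\<infinity>\<beta>\<in>I \<alpha>. ip h (u \<alpha> \<beta>) * ip (v \<alpha> \<beta>) h) \<partial>M) \<and>
            (\<integral>\<alpha>. (\<Sum>\<^sub>\<infinity>\<beta>\<in>I \<alpha>. ip h (u \<alpha> \<beta>) * ip (v \<alpha> \<beta>) h) \<partial>M) \<le> of_real (b * (norm h)\<^sup>2)) \<and>
          cond_B c d)) \<and>
     (\<forall>b. continuous_bessel_bound scl ip scl0 ip0 M A \<Psi> b \<longleftrightarrow>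
        cond_M \<and>
        (\<exists>c>0. \<exists>d>0. \<exists>r>0.
          (\<forall>h.
            weak_integrable ip M (\<lambda>\<alpha>. \<Sum>\<^sub>\<infinity>\<beta>\<in>I \<alpha>. scl (ip h (u \<alpha> \<beta>)) (v \<alpha> \<beta>)) \<and>
            weak_integrable ip M (\<lambda>\<alpha>. \<Sum>\<^sub>\<infinity>\<beta>\<in>I \<alpha>. scl (ip h (v \<alpha> \<beta>)) (u \<alpha> \<beta>)) \<and>
            integrable M (\<lambda>\<alpha>. \<Sum>\<^sub>\<infinity>\<beta>\<in>I \<alpha>. ip h (u \<alpha> \<beta>) * ip (v \<alpha> \<beta>) h) \<and>
            norm (weak_integral ip M (\<lambda>\<alpha>. \<Sum>\<^sub>\<infinity>\<beta>\<in>I \<alpha>. scl (ip h (u \<alpha> \<beta>)) (v \<alpha> \<beta>))) \<le> r * norm h \<and>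
            weak_integral ip M (\<lambda>\<alpha>. \<Sum>\<^sub>\<infinity>\<beta>\<in>I \<alpha>. scl (ip h (u \<alpha> \<beta>)) (v \<alpha> \<beta>)) =
              weak_integral ip M (\<lambda>\<alpha>. \<Sum>\<^sub>\<infinity>\<beta>\<in>I \<alpha>. scl (ip h (v \<alpha> \<beta>)) (u \<alpha> \<beta>)) \<and>
            0 \<le> (\<integral>\<alpha>. (\<Sum>\<^sub>\<infinity>\<beta>\<in>I \<alpha>. ip h (u \<alpha> \<beta>) * ip (v \<alpha> \<beta>) h) \<partial>M) \<and>
            (\<integral>\<alpha>. (\<Sum>\<^sub>\<infinity>\<beta>\<in>I \<alpha>. ip h (u \<alpha> \<beta>) * ip (v \<alpha> \<beta>) h) \<partial>M) \<le> of_real (b * (norm h)\<^sup>2)) \<and>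
          cond_B c d))"
proof -
  interpret hilbert_space_pair scl ip scl0 ip0 using H H0 by (simp add: hilbert_space_pair_def)
  let ?F = "\<lambda>h \<alpha>. adj ip ip0 (\<Psi> \<alpha>) (A \<alpha> h)" and ?F' = "\<lambda>h \<alpha>. adj ip ip0 (A \<alpha>) (\<Psi> \<alpha> h)"
  let ?S = "frame_op ip ip0 M A \<Psi>"
  define meas where "meas \<longleftrightarrow>
        (\<forall>h. (\<lambda>\<alpha>. A \<alpha> h) \<in> borel_measurable M \<and> (\<lambda>\<alpha>. \<Psi> \<alpha> h) \<in> borel_measurable M)"
  define bd where "bd B c \<longleftrightarrow>
        (\<forall>h. (\<integral>\<^sup>+\<alpha>. ennreal ((norm (B \<alpha> h))\<^sup>2) \<partial>M) \<le> ennreal (c * (norm h)\<^sup>2))" for B :: "'a \<Rightarrow> 'h \<Rightarrow> 'g" and c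
  have sum_e: "(\<Sum>\<^sub>\<infinity>\<beta>\<in>I \<alpha>. scl0 (ip h (u \<alpha> \<beta>)) (e \<alpha> \<beta>)) = A \<alpha> h"
      "(\<Sum>\<^sub>\<infinity>\<beta>\<in>I \<alpha>. scl0 (ip h (v \<alpha> \<beta>)) (e \<alpha> \<beta>)) = \<Psi> \<alpha> h"
    and sum_norm: "(\<Sum>\<^sub>\<infinity>\<beta>\<in>I \<alpha>. ennreal ((norm (ip h (u \<alpha> \<beta>)))\<^sup>2)) = ennreal ((norm (A \<alpha> h))\<^sup>2)"
      "(\<Sum>\<^sub>\<infinity>\<beta>\<in>I \<alpha>. ennreal ((norm (ip h (v \<alpha> \<beta>)))\<^sup>2)) = ennreal ((norm (\<Psi> \<alpha> h))\<^sup>2)"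
    and sum_uv: "(\<Sum>\<^sub>\<infinity>\<beta>\<in>I \<alpha>. scl (ip h (u \<alpha> \<beta>)) (v \<alpha> \<beta>)) = ?F h \<alpha>"
      "(\<Sum>\<^sub>\<infinity>\<beta>\<in>I \<alpha>. scl (ip h (v \<alpha> \<beta>)) (u \<alpha> \<beta>)) = ?F' h \<alpha>"
    and sum_ip: "(\<Sum>\<^sub>\<infinity>\<beta>\<in>I \<alpha>. ip h (u \<alpha> \<beta>) * ip (v \<alpha> \<beta>) h) = ip0 (A \<alpha> h) (\<Psi> \<alpha> h)"
    if \<alpha>: "\<alpha> \<in> space M" for \<alpha> h
    using infsum_adj_basis[OF A[OF \<alpha>] e[OF \<alpha>]] infsum_adj_basis[OF \<Psi>[OF \<alpha>] e[OF \<alpha>]]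
      infsum_norm_adj_basis[OF A[OF \<alpha>] e[OF \<alpha>]] infsum_norm_adj_basis[OF \<Psi>[OF \<alpha>] e[OF \<alpha>]]
      infsum_adj_adj_basis[OF A[OF \<alpha>] \<Psi>[OF \<alpha>] e[OF \<alpha>]]
      infsum_adj_adj_basis[OF \<Psi>[OF \<alpha>] A[OF \<alpha>] e[OF \<alpha>]]
      infsum_ip_adj_basis[OF A[OF \<alpha>] \<Psi>[OF \<alpha>] e[OF \<alpha>]]
    by (simp_all add: u[OF \<alpha>] v[OF \<alpha>] cong: infsum_cong)
  have M_iff: "cond_M \<longleftrightarrow> meas"
    unfolding cond_M meas_def by (simp add: sum_e cong: measurable_cong)
  have B_iff: "cond_B c d \<longleftrightarrow> bd A c \<and> bd \<Psi> d" for c d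
    unfolding cond_B bd_def by (simp add: sum_norm all_conj_distrib cong: nn_integral_cong)
  \<comment> \<open>Equality of the predicates, with the value left free, transports both existence
    and the definite description behind \<open>weak_integral\<close>.\<close>
  have hwi: "has_weak_integral ip M (\<lambda>\<alpha>. \<Sum>\<^sub>\<infinity>\<beta>\<in>I \<alpha>. scl (ip h (u \<alpha> \<beta>)) (v \<alpha> \<beta>)) =
        has_weak_integral ip M (?F h)"
      "has_weak_integral ip M (\<lambda>\<alpha>. \<Sum>\<^sub>\<infinity>\<beta>\<in>I \<alpha>. scl (ip h (v \<alpha> \<beta>)) (u \<alpha> \<beta>)) =
        has_weak_integral ip M (?F' h)" for h
    by (intro ext has_weak_integral_cong sum_uv; assumption)+
  have wi: "weak_integrable ip M (\<lambda>\<alpha>. \<Sum>\<^sub>\<infinity>\<beta>\<in>I \<alpha>. scl (ip h (u \<alpha> \<beta>)) (v \<alpha> \<beta>)) =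
        weak_integrable ip M (?F h)"
      "weak_integrable ip M (\<lambda>\<alpha>. \<Sum>\<^sub>\<infinity>\<beta>\<in>I \<alpha>. scl (ip h (v \<alpha> \<beta>)) (u \<alpha> \<beta>)) =
        weak_integrable ip M (?F' h)"
      "weak_integral ip M (\<lambda>\<alpha>. \<Sum>\<^sub>\<infinity>\<beta>\<in>I \<alpha>. scl (ip h (u \<alpha> \<beta>)) (v \<alpha> \<beta>)) = ?S h"
      "weak_integral ip M (\<lambda>\<alpha>. \<Sum>\<^sub>\<infinity>\<beta>\<in>I \<alpha>. scl (ip h (v \<alpha> \<beta>)) (u \<alpha> \<beta>)) =
        frame_op ip ip0 M \<Psi> A h" for h
    by (simp_all add: weak_integrable_def weak_integral_def frame_op_def hwi)
  have T_eq: "T = ?S" using T wi(3) by auto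
  have ip_int: "integrable M (\<lambda>\<alpha>. \<Sum>\<^sub>\<infinity>\<beta>\<in>I \<alpha>. ip h (u \<alpha> \<beta>) * ip (v \<alpha> \<beta>) h) \<longleftrightarrow>
        integrable M (\<lambda>\<alpha>. ip0 (A \<alpha> h) (\<Psi> \<alpha> h))" for h
    by (rule Bochner_Integration.integrable_cong) (simp_all add: sum_ip)
  have ip_integral: "(\<integral>\<alpha>. (\<Sum>\<^sub>\<infinity>\<beta>\<in>I \<alpha>. ip h (u \<alpha> \<beta>) * ip (v \<alpha> \<beta>) h) \<partial>M) =
        (\<integral>\<alpha>. ip0 (A \<alpha> h) (\<Psi> \<alpha> h) \<partial>M)" for h
    by (rule Bochner_Integration.integral_cong) (simp_all add: sum_ip)
  have bessel: "continuous_bessel scl ip scl0 ip0 M A \<Psi> \<longleftrightarrow> meas \<and> (\<exists>c>0. bd A c) \<and> (\<exists>d>0. bd \<Psi> d) \<and>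
      (\<forall>h. weak_integrable ip M (?F h)) \<and> bounded_op scl scl ?S \<and> positive_op ip ?S"
  \<comment> \<open>The characterization of bounded analysis operators presupposes measurability;
    when that fails, both sides are false.\<close>
  proof (cases meas)
    case True
    then have "bounded_op_L2 scl scl0 M (analysis_op A) \<longleftrightarrow> (\<exists>c>0. bd A c)"
        "bounded_op_L2 scl scl0 M (analysis_op \<Psi>) \<longleftrightarrow> (\<exists>d>0. bd \<Psi> d)"
      unfolding bd_def meas_def using A \<Psi> by (simp_all add: bounded_op_L2_analysis_op_iff)
    then show ?thesis using A \<Psi> unfolding continuous_bessel_def meas_def by blast
  next
    case False
    then show ?thesis unfolding continuous_bessel_def meas_def by blast
  qed
  have "\<forall>\<alpha>\<in>space M. bounded_op scl scl0 (A \<alpha>)" "\<forall>\<alpha>\<in>space M. bounded_op scl scl0 (\<Psi> \<alpha>)"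
    using A \<Psi> by blast+
  note core = frame_op_conditions_iff[OF this]
  \<comment> \<open>Supplies the invertibility clause of a frame from the lower bound, for (i) and
    (iii) alike.\<close>
  have coercive: "invertible_op scl ?S"
        if "a > 0" "bounded_op scl scl ?S" "op_bounds ip ?S a b" for a b
    using H.invertible_of_coercive[OF that(2,1)] that(3) by (simp add: op_bounds_def)
  \<comment> \<open>The constants for \<open>A\<close> and \<open>\<Psi>\<close> are independent, so
    their quantifiers are separated here and recombined in the final goals.\<close>
  have frame: "continuous_ov_frame_bounds scl ip scl0 ip0 M A \<Psi> a b \<longleftrightarrow>
        meas \<and> (\<exists>c>0. bd A c) \<and> (\<exists>d>0. bd \<Psi> d) \<and>
      (\<forall>h. weak_integrable ip M (?F h)) \<and> bounded_op scl scl ?S \<and> positive_op ip ?S \<and> op_bounds ip ?S a b"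
        if "a > 0" for a b
    unfolding continuous_ov_frame_bounds_def continuous_ov_frame_def bessel
    using coercive[OF that] by blast
  have bessel_bound: "continuous_bessel_bound scl ip scl0 ip0 M A \<Psi> b \<longleftrightarrow>
        meas \<and> (\<exists>c>0. bd A c) \<and> (\<exists>d>0. bd \<Psi> d) \<and>
      (\<forall>h. weak_integrable ip M (?F h)) \<and> bounded_op scl scl ?S \<and> positive_op ip ?S \<and> op_bounds ip ?S 0 b" for b
    unfolding continuous_bessel_bound_def bessel by blast
  have op_bounds0: "op_bounds ip ?S 0 b \<longleftrightarrow>
        (\<forall>h. 0 \<le> ip (?S h) h \<and> ip (?S h) h \<le> of_real (b * (norm h)\<^sup>2))" for b
    by (simp add: op_bounds_def)
  show ?thesis
    unfolding M_iff B_iff wi T_eq ip_int ip_integral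
  proof (intro conjI allI impI)
    fix a b :: real assume "a > 0"
    show "continuous_ov_frame_bounds scl ip scl0 ip0 M A \<Psi> a b \<longleftrightarrow> meas \<and> (\<exists>c>0. \<exists>d>0.
          (\<forall>h. weak_integrable ip M (?F h)) \<and>
          bounded_op scl scl ?S \<and> positive_op ip ?S \<and> invertible_op scl ?S \<and>
          (\<forall>h. of_real (a * (norm h)\<^sup>2) \<le> ip (?S h) h \<and> ip (?S h) h \<le> of_real (b * (norm h)\<^sup>2)) \<and>
          bd A c \<and> bd \<Psi> d)"
      unfolding frame[OF \<open>a > 0\<close>] op_bounds_def[symmetric] using coercive[OF \<open>a > 0\<close>] by blast
  next
    fix b
    show "continuous_bessel_bound scl ip scl0 ip0 M A \<Psi> b \<longleftrightarrow> meas \<and> (\<exists>c>0. \<exists>d>0.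
          (\<forall>h. weak_integrable ip M (?F h)) \<and> bounded_op scl scl ?S \<and> positive_op ip ?S \<and>
          (\<forall>h. 0 \<le> ip (?S h) h \<and> ip (?S h) h \<le> of_real (b * (norm h)\<^sup>2)) \<and>
          bd A c \<and> bd \<Psi> d)"
      unfolding bessel_bound op_bounds0 by blast
  next
    fix a b :: real assume "a > 0"
    show "continuous_ov_frame_bounds scl ip scl0 ip0 M A \<Psi> a b \<longleftrightarrow> meas \<and> (\<exists>c>0. \<exists>d>0. \<exists>r>0.
          (\<forall>h. weak_integrable ip M (?F h) \<and> weak_integrable ip M (?F' h) \<and>
            integrable M (\<lambda>\<alpha>. ip0 (A \<alpha> h) (\<Psi> \<alpha> h)) \<and> norm (?S h) \<le> r * norm h \<and>
            ?S h = frame_op ip ip0 M \<Psi> A h \<and>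
            of_real (a * (norm h)\<^sup>2) \<le> (\<integral>\<alpha>. ip0 (A \<alpha> h) (\<Psi> \<alpha> h) \<partial>M) \<and>
            (\<integral>\<alpha>. ip0 (A \<alpha> h) (\<Psi> \<alpha> h) \<partial>M) \<le> of_real (b * (norm h)\<^sup>2)) \<and> bd A c \<and> bd \<Psi> d)"
      unfolding frame[OF \<open>a > 0\<close>] core[OF less_imp_le[OF \<open>a > 0\<close>]] by blast
  next
    fix b
    show "continuous_bessel_bound scl ip scl0 ip0 M A \<Psi> b \<longleftrightarrow> meas \<and> (\<exists>c>0. \<exists>d>0. \<exists>r>0.
          (\<forall>h. weak_integrable ip M (?F h) \<and> weak_integrable ip M (?F' h) \<and>
            integrable M (\<lambda>\<alpha>. ip0 (A \<alpha> h) (\<Psi> \<alpha> h)) \<and> norm (?S h) \<le> r * norm h \<and>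
            ?S h = frame_op ip ip0 M \<Psi> A h \<and>
            0 \<le> (\<integral>\<alpha>. ip0 (A \<alpha> h) (\<Psi> \<alpha> h) \<partial>M) \<and>
            (\<integral>\<alpha>. ip0 (A \<alpha> h) (\<Psi> \<alpha> h) \<partial>M) \<le> of_real (b * (norm h)\<^sup>2)) \<and> bd A c \<and> bd \<Psi> d)"
      \<comment> \<open>\<open>order_refl\<close> instantiates the lower bound to \<open>0\<close>,
        and \<open>simp\<close> reduces the resulting
        \<open>of_real (0 * (norm h)\<^sup>2)\<close>.\<close>
      unfolding bessel_bound core[OF order_refl] by simp blast
  qed
qed

end
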